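(* Let $(G,V,E)$ be a graph and $n \geq 0$. The Euler characteristic of $\mathrm{Conf}_n^{\mathrm{sink}}(G,V)$ is given by $$\chi(\mathrm{Conf}_n^{\mathrm{sink}}(G,V))=\sum_{i=0}^{|E|}(-1)^i\binom{n}{i}\binom{|E|}{i}\,i!\,|V|^{n-i}.$$ In particular, the Euler characteristic of $\mathrm{Conf}_n^{\mathrm{sink}}(G,V)$ depends only on $n$, $|E|$ and $|V|$.
   Context: A graph $(G,V,E)$ is a compact connected CW complex $G$ of dimension one together with its set $V$ of 0-cells (vertices) and its set $E$ of 1-cells (edges); loops and multiple edges are allowed. The $n$-th sink configuration space is $\mathrm{Conf}_n^{\mathrm{sink}}(G,V)=\{(x_1,\dots,x_n)\in G^n \mid \text{for all } i\neq j:\ x_i\neq x_j \text{ or } x_i=x_j\in V\}$, with the subspace topology from $G^n$. Terms with $i>n$ vanish since $\binom{n}{i}=0$. *)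

theory Defs
  imports "HOL-Homology.Homology" "HOL-Library.Disjoint_Sets" "HOL-Library.Extended_Nat"
begin

section \<open>Graphs as CW complexes\<close>

text \<open>An edge is an open 1-cell, hence a subset of the space. Parallel edges are therefore distinct
  sets even when they have the same end points, and a loop is an edge whose characteristic map takes
  the same value at 0 and 1.\<close>

definition characteristic_map :: "'a topology \<Rightarrow> 'a set \<Rightarrow> 'a set \<Rightarrow> (real \<Rightarrow> 'a) \<Rightarrow> bool" where
  "characteristic_map X V e \<phi> \<longleftrightarrow>
     continuous_map (top_of_set {0..1}) X \<phi> \<and>
     \<phi> ` {0, 1} \<subseteq> V \<and>
     homeomorphic_map (top_of_set {0<..<1}) (subtopology X e) \<phi>"

text \<open>The last clause is the weak topology. Closed 1-cells suffice there, since the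
  intersection of a set with a closed 0-cell is closed in any Hausdorff space. Closure-finiteness is
  automatic because the boundary of a 1-cell consists of at most two vertices. Dimension exactly one
  means that there is at least one edge.\<close>

definition one_dim_CW_complex :: "'a topology \<Rightarrow> 'a set \<Rightarrow> 'a set set \<Rightarrow> bool" where
  "one_dim_CW_complex X V E \<longleftrightarrow>
     Hausdorff_space X \<and>
     V \<subseteq> topspace X \<and>
     E \<noteq> {} \<and>
     partition_on (topspace X - V) E \<and>
     (\<forall>e\<in>E. \<exists>\<phi>. characteristic_map X V e \<phi>) \<and>
     (\<forall>A\<subseteq>topspace X. (\<forall>e\<in>E. closedin X (A \<inter> X closure_of e)) \<longrightarrow> closedin X A)"

text \<open>Finiteness of \<open>V\<close> and \<open>E\<close> is not assumed; it follows from compactness.\<close>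

definition CW_graph :: "'a topology \<Rightarrow> 'a set \<Rightarrow> 'a set set \<Rightarrow> bool" where
  "CW_graph X V E \<longleftrightarrow> one_dim_CW_complex X V E \<and> compact_space X \<and> connected_space X"

section \<open>Sink configuration spaces\<close>

definition sink_conf :: "nat \<Rightarrow> 'a topology \<Rightarrow> 'a set \<Rightarrow> (nat \<Rightarrow> 'a) topology" where
  "sink_conf n X V =
     subtopology (product_topology (\<lambda>_. X) {1..n})
       {x. \<forall>i\<in>{1..n}. \<forall>j\<in>{1..n}. i \<noteq> j \<longrightarrow> x i \<noteq> x j \<or> (x i = x j \<and> x i \<in> V)}"

section \<open>Euler characteristic\<close>

text \<open>Rank of an abelian group, written multiplicatively as the homology groups in the library are:
  the supremum of the sizes of its finite \<open>\<int>\<close>-linearly independent subsets.\<close>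

definition int_independent :: "('g, 'm) monoid_scheme \<Rightarrow> 'g set \<Rightarrow> bool" where
  "int_independent H S \<longleftrightarrow>
     finite S \<and> S \<subseteq> carrier H \<and>
     (\<forall>a :: 'g \<Rightarrow> int. finprod H (\<lambda>x. x [^]\<^bsub>H\<^esub> a x) S = \<one>\<^bsub>H\<^esub> \<longrightarrow> (\<forall>x\<in>S. a x = 0))"

definition abelian_rank :: "('g, 'm) monoid_scheme \<Rightarrow> enat" where
  "abelian_rank H = (SUP S \<in> {S. int_independent H S}. enat (card S))"

definition betti :: "nat \<Rightarrow> 'a topology \<Rightarrow> enat" where
  "betti p X = abelian_rank (homology_group (int p) X)"

definition euler_defined :: "'a topology \<Rightarrow> bool" where
  "euler_defined X \<longleftrightarrow> (\<forall>p. betti p X \<noteq> \<infinity>) \<and> finite {p. betti p X \<noteq> 0}"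

text \<open>Only meaningful when \<open>euler_defined X\<close> holds; otherwise the value is arbitrary.\<close>

definition euler_characteristic :: "'a topology \<Rightarrow> int" where
  "euler_characteristic X = (\<Sum>p | betti p X \<noteq> 0. (-1) ^ p * int (the_enat (betti p X)))"

end

theory Submission
  imports Defs
begin

text \<open>
  The Euler characteristic is computed by puncturing the edges one after another, without any cell
  structure on the configuration space.

  Let \<open>F(n, m)\<close> be the Euler characteristic of the space of sink configurations of \<open>n\<close> particles in
  which \<open>m\<close> edges may still be crossed, the midpoints of the other edges being forbidden. Forbidding
  the midpoint of one more edge \<open>e\<close> removes the closed set where some particle sits there. At most one
  particle \<open>p\<close> can do so, since the midpoint is not a vertex, and near this set the position of \<open>p\<close>
  varies in an open interval around the midpoint while the others form an arbitrary configuration of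
  \<open>n - 1\<close> particles avoiding the midpoint. So a piece equivalent to the smaller configuration space is
  glued in along two copies of itself, one on each side of the midpoint, and this happens for each of
  the \<open>n\<close> particles. Inclusion-exclusion for open covers gives
  \<open>F(n, m + 1) = F(n, m) - n * F(n - 1, m)\<close> (\<open>euler_conf_puncture\<close>).

  When all midpoints are forbidden, the graph falls apart into stars around its vertices. Shrinking
  them linearly moves every configuration into a finite discrete space, with collisions occurring only
  on vertices, so that \<open>F(n, 0) = |V|^n\<close> (\<open>euler_conf_all_punctured\<close>). The right hand side of the
  formula satisfies the same recursion (\<open>sink_euler_Suc\<close>).

  Inclusion-exclusion (\<open>has_euler_open_Un\<close>) comes from excision and the long exact sequence of a pair;
  the passage from exactness to alternating sums of Betti numbers uses the additivity of the rank of
  abelian groups (\<open>rank_nullity\<close>).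
\<close>

section \<open>Ranks of abelian groups\<close>

text \<open>Integer combinations of a finite set, in multiplicative notation. Ranks are compared entirely
  through these, without passing to a vector space over the rationals.\<close>

definition int_comb :: "('g, 'm) monoid_scheme \<Rightarrow> ('g \<Rightarrow> int) \<Rightarrow> 'g set \<Rightarrow> 'g" where
  "int_comb G a S = finprod G (\<lambda>x. x [^]\<^bsub>G\<^esub> a x) S"

lemma int_independent_iff:
  "int_independent G S \<longleftrightarrow> finite S \<and> S \<subseteq> carrier G \<and>
     (\<forall>a. int_comb G a S = \<one>\<^bsub>G\<^esub> \<longrightarrow> (\<forall>x\<in>S. a x = 0))"
  by (simp add: int_independent_def int_comb_def)

text \<open>Gaussian elimination without division: a pivot row is used to clear one column, after multiplying
  through by the pivot, and the induction continues with one equation and one unknown less.\<close>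

lemma underdetermined_int_system:
  fixes a :: "'t \<Rightarrow> 's \<Rightarrow> int"
  assumes "finite S" "finite T" "card S < card T"
  shows "\<exists>c. (\<exists>t\<in>T. c t \<noteq> 0) \<and> (\<forall>s\<in>S. (\<Sum>t\<in>T. c t * a t s) = 0)"
  using assms
proof (induction S arbitrary: T a rule: finite_induct)
  case empty
  then have "T \<noteq> {}" by auto
  then show ?case by (intro exI[of _ "\<lambda>_. 1"]) auto
next
  case (insert s S)
  show ?case
  proof (cases "\<forall>t\<in>T. a t s = 0")
    case True
    have "card S < card T" using insert by auto
    from insert.IH[OF insert.prems(1) this, of a] True show ?thesis by auto
  next
    case False
    then obtain u where u: "u \<in> T" "a u s \<noteq> 0" by blast
    define a' where "a' = (\<lambda>t r. a u s * a t r - a t s * a u r)"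
    have "card S < card (T - {u})" using insert u by auto
    from insert.IH[OF _ this, of a'] insert.prems obtain c where
      c: "\<exists>t\<in>T - {u}. c t \<noteq> 0" "\<And>r. r \<in> S \<Longrightarrow> (\<Sum>t\<in>T - {u}. c t * a' t r) = 0" by auto
    \<comment> \<open>the coefficient of the pivot row is chosen to cancel column \<open>s\<close>\<close>
  define d where "d = (\<lambda>t. if t = u then - (\<Sum>t\<in>T - {u}. c t * a t s) else c t * a u s)"
    have split: "(\<Sum>t\<in>T. d t * a t r) = d u * a u r + (\<Sum>t\<in>T - {u}. c t * a u s * a t r)" for r
    proof -
      have "(\<Sum>t\<in>T - {u}. d t * a t r) = (\<Sum>t\<in>T - {u}. c t * a u s * a t r)"
        by (rule sum.cong) (auto simp: d_def)
      then show ?thesis using sum.remove[OF insert.prems(1) u(1), of "\<lambda>t. d t * a t r"] by simp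
    qed
    have "(\<Sum>t\<in>T. d t * a t r) = 0" if "r \<in> insert s S" for r
    proof (cases "r = s")
      case True
      have "(\<Sum>t\<in>T - {u}. c t * a u s * a t s) = (\<Sum>t\<in>T - {u}. c t * a t s) * a u s"
        by (simp add: sum_distrib_left mult_ac)
      then show ?thesis unfolding split using True by (simp add: d_def)
    next
      case False
      have "0 = (\<Sum>t\<in>T - {u}. c t * a' t r)" using c(2) that False by simp
      also have "\<dots> = (\<Sum>t\<in>T - {u}. c t * a u s * a t r) - (\<Sum>t\<in>T - {u}. c t * a t s) * a u r"
        by (simp add: a'_def algebra_simps sum_subtractf sum_distrib_left)
      finally show ?thesis unfolding split by (simp add: d_def)
    qed
    moreover have "\<exists>t\<in>T. d t \<noteq> 0" using c(1) u by (auto simp: d_def)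
    ultimately show ?thesis by blast
  qed
qed

context comm_group
begin

lemma int_comb_closed: "S \<subseteq> carrier G \<Longrightarrow> int_comb G a S \<in> carrier G"
  unfolding int_comb_def by (rule finprod_closed) auto

lemma int_comb_cong: "S \<subseteq> carrier G \<Longrightarrow> (\<And>x. x \<in> S \<Longrightarrow> a x = b x) \<Longrightarrow> int_comb G a S = int_comb G b S"
  unfolding int_comb_def by (rule finprod_cong') auto

lemma int_comb_insert:
  assumes "finite S" "S \<subseteq> carrier G" "x \<in> carrier G" "x \<notin> S"
  shows "int_comb G a (insert x S) = x [^] a x \<otimes> int_comb G a S"
  unfolding int_comb_def using assms by (subst finprod_insert) auto

lemma int_comb_zero: "S \<subseteq> carrier G \<Longrightarrow> (\<And>x. x \<in> S \<Longrightarrow> a x = 0) \<Longrightarrow> int_comb G a S = \<one>"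
  unfolding int_comb_def by (rule finprod_one_eqI) simp

lemma int_comb_add:
  assumes "S \<subseteq> carrier G"
  shows "int_comb G (\<lambda>x. a x + b x) S = int_comb G a S \<otimes> int_comb G b S"
proof -
  have "int_comb G (\<lambda>x. a x + b x) S = finprod G (\<lambda>x. x [^] a x \<otimes> x [^] b x) S"
    unfolding int_comb_def using assms by (intro finprod_cong') (auto simp: int_pow_mult)
  also have "\<dots> = int_comb G a S \<otimes> int_comb G b S"
    unfolding int_comb_def using assms by (intro finprod_multf) auto
  finally show ?thesis .
qed

lemma int_comb_scale:
  assumes "finite S" "S \<subseteq> carrier G"
  shows "int_comb G (\<lambda>x. k * a x) S = int_comb G a S [^] k"
  using assms
proof (induction S rule: finite_induct)
  case empty
  then show ?case by (simp add: int_comb_def)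
next
  case (insert x S)
  then show ?case
    by (simp add: int_comb_insert int_comb_closed int_pow_distrib int_pow_pow mult.commute)
qed

lemma int_comb_Un:
  assumes "finite S" "finite T" "S \<inter> T = {}" "S \<subseteq> carrier G" "T \<subseteq> carrier G"
  shows "int_comb G a (S \<union> T) = int_comb G a S \<otimes> int_comb G a T"
  unfolding int_comb_def using assms by (intro finprod_Un_disjoint) auto

lemma int_comb_substitute:
  assumes "finite T" "finite S" "S \<subseteq> carrier G"
  shows "finprod G (\<lambda>t. int_comb G (a t) S [^] (c t :: int)) T
       = int_comb G (\<lambda>s. \<Sum>t\<in>T. c t * a t s) S"
  using assms(1)
proof (induction T rule: finite_induct)
  case empty
  then show ?case using assms by (simp add: int_comb_zero)
next
  case (insert t T)
  then show ?case using assms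
    by (simp add: int_comb_closed Pi_iff int_comb_add int_comb_scale)
qed

text \<open>Only a nonzero multiple of each element has to lie in the span, so this is a basis of \<open>A\<close> up to
  torsion and finite index. Taking \<open>A\<close> as a subset of the ambient group makes it possible to
  speak of the rank of a kernel or an image without forming a new group.\<close>

definition basis_of :: "'a set \<Rightarrow> 'a set \<Rightarrow> bool" where
  "basis_of A S \<longleftrightarrow> int_independent G S \<and> S \<subseteq> A \<and>
     (\<forall>x\<in>A. \<exists>k a. k \<noteq> 0 \<and> x [^] (k::int) = int_comb G a S)"

text \<open>The Steinitz bound. If an independent set were larger than a basis, writing a multiple of each of
  its elements in terms of the basis would give an integer matrix with more rows than columns, and a
  linear relation between the rows is a relation between the independent elements.\<close>

lemma independent_card_le_basis:
  assumes S: "basis_of A S" and T: "int_independent G T" "T \<subseteq> A"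
  shows "card T \<le> card S"
proof (rule ccontr)
  assume "\<not> card T \<le> card S"
  have fin: "finite S" "finite T" and car: "S \<subseteq> carrier G" "T \<subseteq> carrier G"
    using S T by (auto simp: basis_of_def int_independent_def)
  obtain k a where ka: "\<And>t. t \<in> T \<Longrightarrow> k t \<noteq> 0 \<and> t [^] (k t :: int) = int_comb G (a t) S"
    using S T(2) unfolding basis_of_def by (metis subsetD)
  obtain c where c: "\<exists>t\<in>T. c t \<noteq> 0" "\<forall>s\<in>S. (\<Sum>t\<in>T. c t * a t s) = 0"
    using underdetermined_int_system[OF fin, of a] \<open>\<not> card T \<le> card S\<close> by auto
  have "int_comb G (\<lambda>t. k t * c t) T = finprod G (\<lambda>t. int_comb G (a t) S [^] c t) T"
    unfolding int_comb_def[of G _ T]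
  proof (rule finprod_cong')
    fix t assume t: "t \<in> T"
    then show "t [^] (k t * c t) = int_comb G (a t) S [^] c t"
      using ka[OF t] car by (metis int_pow_pow subsetD)
  qed (use car in \<open>auto simp: int_comb_closed\<close>)
  also have "\<dots> = \<one>"
    using c(2) car fin by (simp add: int_comb_substitute int_comb_zero)
  finally have "\<forall>t\<in>T. k t * c t = 0"
    using T(1) unfolding int_independent_iff by blast
  then show False using c(1) ka by auto
qed

end

definition rank_in :: "('g, 'm) monoid_scheme \<Rightarrow> 'g set \<Rightarrow> enat" where
  "rank_in G A = (SUP S \<in> {S. int_independent G S \<and> S \<subseteq> A}. enat (card S))"

lemma abelian_rank_eq_rank_in: "abelian_rank G = rank_in G (carrier G)"
  unfolding abelian_rank_def rank_in_def
  by (rule arg_cong[where f = Sup], rule arg_cong[where f = "image _"]) (auto simp: int_independent_def)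

lemma card_le_rank_in: "int_independent G S \<Longrightarrow> S \<subseteq> A \<Longrightarrow> enat (card S) \<le> rank_in G A"
  unfolding rank_in_def by (rule SUP_upper) auto

lemma rank_in_mono: "A \<subseteq> B \<Longrightarrow> rank_in G A \<le> rank_in G B"
  unfolding rank_in_def by (rule SUP_subset_mono) auto

lemma (in comm_group) rank_in_basis:
  assumes "basis_of A S" shows "rank_in G A = enat (card S)"
proof (rule antisym)
  show "rank_in G A \<le> enat (card S)"
    unfolding rank_in_def using independent_card_le_basis[OF assms] by (auto intro!: SUP_least)
  show "enat (card S) \<le> rank_in G A"
    using assms by (auto simp: basis_of_def intro: card_le_rank_in)
qed

text \<open>An independent subset of the largest size is a basis: adding any further element produces a
  relation, in which the coefficient of that element cannot vanish.\<close>

lemma (in comm_group) rank_in_finite_imp_basis: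
  assumes "rank_in G A \<noteq> \<infinity>" "A \<subseteq> carrier G"
  obtains S where "basis_of A S"
proof -
  obtain N where N: "rank_in G A = enat N" using assms(1) by auto
  let ?P = "\<lambda>S. int_independent G S \<and> S \<subseteq> A"
  have "?P {}" by (simp add: int_independent_def)
  moreover have "card S < Suc N" if "?P S" for S
    using card_le_rank_in[of G S A] that N by simp
  ultimately obtain S where S: "?P S" and max: "\<And>T. ?P T \<Longrightarrow> card T \<le> card S"
    using ex_has_greatest_nat[of ?P "{}" card "Suc N"] by auto
  have fin: "finite S" "S \<subseteq> carrier G" using S by (auto simp: int_independent_def)
  have "\<exists>k a. k \<noteq> 0 \<and> x [^] (k::int) = int_comb G a S" if x: "x \<in> A" for x
  proof (cases "x \<in> S")
    case True
    have "int_comb G (\<lambda>y. if y = x then 1 else 0) S = x"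
      using int_comb_insert[of "S - {x}" x "\<lambda>y. if y = x then 1 else 0"]
        int_comb_zero[of "S - {x}" "\<lambda>y. if y = x then 1 else 0"] fin True
      by (auto simp: insert_absorb)
    moreover have "x [^] (1::int) = x" using True fin by auto
    ultimately show ?thesis by (metis zero_neq_one)
  next
    case False
    have xc: "x \<in> carrier G" using x assms by auto
    have "\<not> ?P (insert x S)" using max[of "insert x S"] False fin by auto
    then obtain a y where a: "int_comb G a (insert x S) = \<one>" "y \<in> insert x S" "a y \<noteq> 0"
      using S x fin xc unfolding int_independent_iff by auto
    have *: "x [^] a x \<otimes> int_comb G a S = \<one>"
      using a(1) fin xc False by (simp add: int_comb_insert)
    have "a x \<noteq> 0"
    proof
      assume "a x = 0"
      then have "int_comb G a S = \<one>" using * fin by (simp add: int_comb_closed)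
      then have "\<forall>x\<in>S. a x = 0" using S unfolding int_independent_iff by blast
      with a \<open>a x = 0\<close> show False by auto
    qed
    moreover have "x [^] a x = int_comb G a S [^] (-1 :: int)"
      using * xc fin by (simp add: int_pow_neg int_comb_closed inv_equality)
    then have "x [^] a x = int_comb G (\<lambda>y. - 1 * a y) S"
      using int_comb_scale[of S "-1" a] fin by simp
    ultimately show ?thesis by blast
  qed
  then have "basis_of A S" using S by (simp add: basis_of_def)
  then show ?thesis by (rule that)
qed

lemma independent_one_notin:
  assumes "comm_group G" "int_independent G S" shows "\<one>\<^bsub>G\<^esub> \<notin> S"
proof
  interpret comm_group G by fact
  assume one: "\<one>\<^bsub>G\<^esub> \<in> S"
  let ?a = "\<lambda>x. if x = \<one>\<^bsub>G\<^esub> then (1::int) else 0"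
  have "int_comb G ?a S = \<one>\<^bsub>G\<^esub>"
    unfolding int_comb_def by (rule finprod_one_eqI) auto
  then have "?a \<one>\<^bsub>G\<^esub> = 0" using assms(2) one unfolding int_independent_iff by blast
  then show False by simp
qed

lemma rank_in_one:
  assumes "comm_group G" shows "rank_in G {\<one>\<^bsub>G\<^esub>} = 0"
proof -
  have "{S. int_independent G S \<and> S \<subseteq> {\<one>\<^bsub>G\<^esub>}} = {{}}"
    using independent_one_notin[OF assms] by (auto simp: int_independent_def subset_singleton_iff)
  then show ?thesis by (simp add: rank_in_def zero_enat_def)
qed

locale comm_group_hom = G?: comm_group G + H?: comm_group H
  for G (structure) and H (structure) +
  fixes h
  assumes hom: "h \<in> hom G H"
begin

lemma is_group_hom: "group_hom G H h"
  using hom by (simp add: group_hom_def group_hom_axioms_def G.is_group H.is_group)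

lemma hom_int_comb:
  assumes "finite S" "S \<subseteq> carrier G" "inj_on h S"
  shows "h (int_comb G (\<lambda>x. b (h x)) S) = int_comb H b (h ` S)"
proof -
  interpret gh: group_hom G H h by (rule is_group_hom)
  show ?thesis using assms
  proof (induction S rule: finite_induct)
    case empty
    then show ?case by (simp add: int_comb_def)
  next
    case (insert x S)
    have "int_comb H b (insert (h x) (h ` S)) = h x [^]\<^bsub>H\<^esub> b (h x) \<otimes>\<^bsub>H\<^esub> int_comb H b (h ` S)"
      using insert by (intro H.int_comb_insert) auto
    with insert show ?case
      by (subst G.int_comb_insert) (auto simp: G.int_comb_closed gh.hom_int_pow)
  qed
qed

text \<open>Applying the homomorphism to a relation kills the kernel part and forces the coefficients on the
  lifted elements to vanish; what remains is a relation inside the kernel.\<close>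

lemma kernel_independent_Un_lift:
  assumes K: "int_independent G K" "K \<subseteq> kernel G H h"
    and L: "finite L" "L \<subseteq> carrier G" "inj_on h L" "int_independent H (h ` L)"
  shows "int_independent G (K \<union> L)" "K \<inter> L = {}"
proof -
  interpret gh: group_hom G H h by (rule is_group_hom)
  have finK: "finite K" "K \<subseteq> carrier G" using K by (auto simp: int_independent_def)
  show disj: "K \<inter> L = {}"
    using independent_one_notin[OF H.comm_group_axioms L(4)] K(2) by (force simp: kernel_def)
  have hK: "h (int_comb G a K) = \<one>\<^bsub>H\<^esub>" for a
    using finK(1) K(2)
  proof (induction K rule: finite_induct)
    case (insert x K)
    then show ?case
      by (subst G.int_comb_insert) (auto simp: kernel_def gh.hom_int_pow G.int_comb_closed subset_iff)
  qed (simp add: int_comb_def)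
  have "\<forall>x\<in>K \<union> L. a x = 0" if a: "int_comb G a (K \<union> L) = \<one>" for a
  proof -
    have split: "int_comb G a K \<otimes> int_comb G a L = \<one>"
      using a finK L disj by (simp add: G.int_comb_Un)
    define b where "b = a \<circ> inv_into L h"
    have ab: "a x = b (h x)" if "x \<in> L" for x using L(3) that by (simp add: b_def)
    have "h (int_comb G a L) = int_comb H b (h ` L)"
      using G.int_comb_cong[OF L(2), of a "\<lambda>x. b (h x)"] ab hom_int_comb[OF L(1-3)] by simp
    moreover have "h (int_comb G a L) = \<one>\<^bsub>H\<^esub>"
      using arg_cong[OF split, of h] hK finK L by (simp add: G.int_comb_closed)
    ultimately have "\<forall>y\<in>h ` L. b y = 0" using L(4) unfolding int_independent_iff by simp
    then have aL: "\<forall>x\<in>L. a x = 0" using ab by simp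
    then have "int_comb G a L = \<one>" using L by (simp add: G.int_comb_zero)
    then have "int_comb G a K = \<one>" using split finK by (simp add: G.int_comb_closed)
    then have "\<forall>x\<in>K. a x = 0" using K(1) unfolding int_independent_iff by blast
    with aL show ?thesis by blast
  qed
  then show "int_independent G (K \<union> L)" using finK L unfolding int_independent_iff by auto
qed

lemma lift_subset_image:
  assumes "finite I" "I \<subseteq> h ` carrier G"
  obtains L where "finite L" "L \<subseteq> carrier G" "inj_on h L" "h ` L = I" "card L = card I"
  by (metis (no_types, opaque_lifting) assms card_image finite_imageD finite_subset_image subset_image_inj)

text \<open>Some multiple of \<open>h x\<close> is a combination of the basis of the image; subtracting the lifted
  combination from the same multiple of \<open>x\<close> gives an element of the kernel.\<close>

lemma kernel_basis_Un_lift: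
  assumes K: "G.basis_of (kernel G H h) K" and L: "finite L" "L \<subseteq> carrier G" "inj_on h L"
    and I: "H.basis_of (h ` carrier G) (h ` L)"
  shows "G.basis_of (carrier G) (K \<union> L)"
proof -
  interpret gh: group_hom G H h by (rule is_group_hom)
  have K': "int_independent G K" "K \<subseteq> kernel G H h" and finK: "finite K" "K \<subseteq> carrier G"
    using K by (auto simp: G.basis_of_def int_independent_def)
  have I': "int_independent H (h ` L)" using I by (simp add: H.basis_of_def)
  note KL = kernel_independent_Un_lift[OF K' L I']
  have "\<exists>k a. k \<noteq> 0 \<and> x [^] (k::int) = int_comb G a (K \<union> L)" if x: "x \<in> carrier G" for x
  proof -
    obtain k b where k: "k \<noteq> 0" "h x [^]\<^bsub>H\<^esub> (k::int) = int_comb H b (h ` L)"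
      using I x unfolding H.basis_of_def by blast
    define l where "l = int_comb G (\<lambda>x. b (h x)) L"
    have l: "l \<in> carrier G" using L by (simp add: l_def G.int_comb_closed)
    have "h l = h (x [^] k)"
      using k(2) x by (simp add: l_def hom_int_comb[OF L] gh.hom_int_pow)
    then have "x [^] k \<otimes> inv l \<in> kernel G H h"
      using x l by (simp add: kernel_def)
    then obtain m c where m: "m \<noteq> 0" "(x [^] k \<otimes> inv l) [^] (m::int) = int_comb G c K"
      using K unfolding G.basis_of_def by blast
    define a where "a = (\<lambda>y. if y \<in> K then c y else m * b (h y))"
    have "int_comb G a (K \<union> L) = int_comb G a K \<otimes> int_comb G a L"
      using finK L KL by (simp add: G.int_comb_Un)
    also have "int_comb G a K = int_comb G c K"
      using finK by (intro G.int_comb_cong) (auto simp: a_def)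
    also have "int_comb G a L = int_comb G (\<lambda>y. m * b (h y)) L"
      using L KL by (intro G.int_comb_cong) (auto simp: a_def)
    also have "\<dots> = l [^] m" using L by (simp add: l_def G.int_comb_scale)
    also have "int_comb G c K \<otimes> l [^] m = (x [^] k \<otimes> inv l \<otimes> l) [^] m"
      using m(2) x l by (simp add: G.int_pow_distrib)
    also have "\<dots> = x [^] (k * m)" using x l by (simp add: G.m_assoc G.int_pow_pow)
    finally show ?thesis using k m by (metis mult_eq_0_iff)
  qed
  then show ?thesis using KL finK L unfolding G.basis_of_def by auto
qed

lemma rank_in_image_le: "rank_in H (h ` carrier G) \<le> abelian_rank G"
proof -
  have "enat (card I) \<le> abelian_rank G" if I: "int_independent H I" "I \<subseteq> h ` carrier G" for I
  proof -
    have "finite I" using I by (simp add: int_independent_def)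
    from lift_subset_image[OF this I(2)] obtain L where
      L: "finite L" "L \<subseteq> carrier G" "inj_on h L" "h ` L = I" "card L = card I" by blast
    have "int_independent G ({} \<union> L)"
      using L I by (intro kernel_independent_Un_lift) (auto simp: int_independent_def)
    then show ?thesis using L card_le_rank_in[of G L "carrier G"] by (simp add: abelian_rank_eq_rank_in)
  qed
  then show ?thesis by (auto simp: rank_in_def intro!: SUP_least)
qed

text \<open>Valid in the extended natural numbers: an infinite rank of the kernel or of the image forces an
  infinite rank of the whole group.\<close>

lemma rank_nullity: "abelian_rank G = rank_in G (kernel G H h) + rank_in H (h ` carrier G)"
proof (cases "rank_in G (kernel G H h) = \<infinity> \<or> rank_in H (h ` carrier G) = \<infinity>")
  case True
  have "rank_in G (kernel G H h) \<le> abelian_rank G"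
    unfolding abelian_rank_eq_rank_in by (rule rank_in_mono) (auto simp: kernel_def)
  with True rank_in_image_le show ?thesis by auto
next
  case False
  interpret gh: group_hom G H h by (rule is_group_hom)
  obtain K where K: "G.basis_of (kernel G H h) K"
    using G.rank_in_finite_imp_basis[of "kernel G H h"] False by (auto simp: kernel_def)
  obtain I where I: "H.basis_of (h ` carrier G) I"
    using H.rank_in_finite_imp_basis[of "h ` carrier G"] False gh.hom_closed by blast
  have I': "int_independent H I" "finite I" "I \<subseteq> h ` carrier G"
    using I by (auto simp: H.basis_of_def int_independent_def)
  obtain L where L: "finite L" "L \<subseteq> carrier G" "inj_on h L" "h ` L = I" "card L = card I"
    using lift_subset_image[OF I'(2,3)] by blast
  have K': "int_independent G K" "K \<subseteq> kernel G H h" "finite K"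
    using K by (auto simp: G.basis_of_def int_independent_def)
  have "G.basis_of (carrier G) (K \<union> L)"
    using kernel_basis_Un_lift[OF K L(1-3)] I L(4) by simp
  then have "abelian_rank G = enat (card (K \<union> L))"
    by (simp add: abelian_rank_eq_rank_in G.rank_in_basis)
  also have "card (K \<union> L) = card K + card I"
    using kernel_independent_Un_lift(2)[OF K'(1,2) L(1-3)] I' L K' by (simp add: card_Un_disjoint)
  finally show ?thesis using G.rank_in_basis[OF K] H.rank_in_basis[OF I] by simp
qed

end

lemma abelian_rank_trivial:
  assumes "trivial_group G" shows "abelian_rank G = 0"
proof -
  interpret group G using assms by (simp add: trivial_group_def)
  have "comm_group G"
    using assms by (intro group_comm_groupI) (auto simp: trivial_group_def)
  then show ?thesis
    using rank_in_one assms by (simp add: abelian_rank_eq_rank_in trivial_group_def)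
qed

lemma abelian_rank_iso:
  assumes "G \<cong> H" "comm_group G" "comm_group H"
  shows "abelian_rank G = abelian_rank H"
proof -
  obtain h where h: "h \<in> iso G H" using assms(1) by (auto simp: is_iso_def)
  interpret comm_group_hom G H h
    using assms h by (auto simp: comm_group_hom_def comm_group_hom_axioms_def iso_def)
  have "kernel G H h = {\<one>\<^bsub>G\<^esub>}"
    using group_hom.inj_iff_trivial_ker[OF is_group_hom] h by (auto simp: iso_def bij_betw_def)
  moreover have "h ` carrier G = carrier H" using h by (auto simp: iso_def bij_betw_def)
  ultimately show ?thesis
    using rank_nullity rank_in_one[OF assms(2)] by (simp add: abelian_rank_eq_rank_in)
qed

lemma abelian_rank_integer_group: "abelian_rank integer_group = 1"
proof -
  interpret comm_group integer_group by (rule abelian_integer_group)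
  have pow: "int_comb integer_group a {1} = a 1" for a
    using int_comb_insert[of "{}" 1 a] by (simp add: int_comb_def)
  have "basis_of (carrier integer_group) {1}"
    unfolding basis_of_def
  proof (intro conjI ballI)
    show "int_independent integer_group {1}" by (simp add: int_independent_iff pow)
    fix x :: int
    show "\<exists>k a. k \<noteq> 0 \<and> x [^]\<^bsub>integer_group\<^esub> (k::int) = int_comb integer_group a {1}"
      by (rule exI[of _ 1], rule exI[of _ "\<lambda>_. x"]) (simp add: pow)
  qed auto
  then show ?thesis by (simp add: abelian_rank_eq_rank_in rank_in_basis one_enat_def)
qed

section \<open>Alternating sums along long exact sequences\<close>

text \<open>Finiteness and the value are recorded together, so that one induction proves both that the Euler
  characteristic is defined and what it is.\<close>

definition has_alternating_sum :: "(nat \<Rightarrow> enat) \<Rightarrow> int \<Rightarrow> bool" where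
  "has_alternating_sum r c \<longleftrightarrow>
     (\<exists>s N. (\<forall>p. r p = enat (s p)) \<and> (\<forall>p\<ge>N. s p = 0) \<and> c = (\<Sum>p<N. (-1) ^ p * int (s p)))"

lemma has_alternating_sumI:
  assumes "\<And>p. r p = enat (s p)" "\<And>p. p \<ge> N \<Longrightarrow> s p = 0" "c = (\<Sum>p<N. (-1) ^ p * int (s p))"
  shows "has_alternating_sum r c"
  using assms unfolding has_alternating_sum_def by blast

lemma has_alternating_sumE:
  assumes "has_alternating_sum r c"
  obtains s N where "\<And>p. r p = enat (s p)" "\<And>p. p \<ge> N \<Longrightarrow> s p = 0"
    "\<And>M. M \<ge> N \<Longrightarrow> c = (\<Sum>p<M. (-1) ^ p * int (s p))"
proof -
  obtain s N where s: "\<And>p. r p = enat (s p)" "\<And>p. p \<ge> N \<Longrightarrow> s p = 0"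
    "c = (\<Sum>p<N. (-1) ^ p * int (s p))"
    using assms unfolding has_alternating_sum_def by blast
  have "c = (\<Sum>p<M. (-1) ^ p * int (s p))" if "M \<ge> N" for M
    unfolding s(3) by (rule sum.mono_neutral_left) (use that s(2) in auto)
  with s show ?thesis by (intro that)
qed

text \<open>Each of \<open>a\<close>, \<open>b\<close>, \<open>c\<close> splits as the rank of an incoming image plus the rank of an outgoing one, so
  in the alternating sum everything cancels except the connecting term in the top degree.\<close>

lemma alternating_sum_long_exact:
  fixes a b c \<alpha> \<beta> \<delta> :: "nat \<Rightarrow> nat"
  assumes "\<And>p. a p = \<delta> (Suc p) + \<alpha> p" "\<And>p. b p = \<alpha> p + \<beta> p" "\<And>p. c p = \<beta> p + \<delta> p"
    and "\<delta> 0 = 0" "\<delta> N = 0"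
  shows "(\<Sum>p<N. (-1) ^ p * int (b p)) =
    (\<Sum>p<N. (-1) ^ p * int (a p)) + (\<Sum>p<N. (-1) ^ p * int (c p))"
proof -
  have "(\<Sum>p<M. (-1) ^ p * int (b p)) =
    (\<Sum>p<M. (-1) ^ p * int (a p)) + (\<Sum>p<M. (-1) ^ p * int (c p)) + (-1) ^ M * int (\<delta> M)" for M
    by (induction M) (simp_all add: assms(1-4) algebra_simps)
  from this[of N] assms(5) show ?thesis by simp
qed

text \<open>The ranks \<open>a\<close>, \<open>b\<close>, \<open>c\<close> of the subspace, the space and the pair, where \<open>\<alpha>\<close>, \<open>\<beta>\<close>, \<open>\<delta>\<close> are the ranks
  of the images of the inclusion, of the passage to the pair, and of the boundary map.\<close>

context
  fixes a b c \<alpha> \<beta> \<delta> :: "nat \<Rightarrow> enat"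
  assumes a: "\<And>p. a p = \<delta> (Suc p) + \<alpha> p"
    and b: "\<And>p. b p = \<alpha> p + \<beta> p"
    and c: "\<And>p. c p = \<beta> p + \<delta> p"
    and 0: "\<delta> 0 = 0"
begin

lemma long_exact_nat:
  assumes "\<And>p. a p = enat (a' p)" "\<And>p. b p = enat (b' p)" "\<And>p. c p = enat (c' p)"
    "\<delta> N = 0"
  shows "(\<Sum>p<N. (-1) ^ p * int (b' p)) =
    (\<Sum>p<N. (-1) ^ p * int (a' p)) + (\<Sum>p<N. (-1) ^ p * int (c' p))"
proof (rule alternating_sum_long_exact)
  have fin: "\<alpha> p \<noteq> \<infinity>" "\<beta> p \<noteq> \<infinity>" "\<delta> p \<noteq> \<infinity>" for p
    using b[of p] c[of p] assms(2)[of p] assms(3)[of p] plus_eq_infty_iff_enat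
    by (metis enat.distinct(2))+
  show "a' p = the_enat (\<delta> (Suc p)) + the_enat (\<alpha> p)"
    "b' p = the_enat (\<alpha> p) + the_enat (\<beta> p)" "c' p = the_enat (\<beta> p) + the_enat (\<delta> p)" for p
    using a[of p] b[of p] c[of p] assms(1-3)[of p] fin[of p] fin[of "Suc p"] by auto
qed (use 0 assms(4) in \<open>auto simp: zero_enat_def\<close>)

lemma long_exact_middle:
  assumes "has_alternating_sum a A" "has_alternating_sum c C"
  shows "has_alternating_sum b (A + C)"
proof -
  obtain a' N where a': "\<And>p. a p = enat (a' p)" "\<And>p. p \<ge> N \<Longrightarrow> a' p = 0"
    "\<And>M. M \<ge> N \<Longrightarrow> A = (\<Sum>p<M. (-1) ^ p * int (a' p))"
    using has_alternating_sumE[OF assms(1)] by blast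
  obtain c' M where c': "\<And>p. c p = enat (c' p)" "\<And>p. p \<ge> M \<Longrightarrow> c' p = 0"
    "\<And>L. L \<ge> M \<Longrightarrow> C = (\<Sum>p<L. (-1) ^ p * int (c' p))"
    using has_alternating_sumE[OF assms(2)] by blast
  have "b p \<noteq> \<infinity>" for p
    using a[of p] c[of p] b[of p] a'(1)[of p] c'(1)[of p] plus_eq_infty_iff_enat
    by (metis enat.distinct(2))
  then have b': "b p = enat (the_enat (b p))" for p by (metis enat_ord_simps(6) the_enat.simps not_infinity_eq)
  have zero: "b p = 0 \<and> \<delta> p = 0" if "p \<ge> max N M" for p
    using a[of p] c[of p] b[of p] a'[of p] c'[of p] that by (auto simp: zero_enat_def[symmetric])
  show ?thesis
  proof (rule has_alternating_sumI[OF b'])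
    show "the_enat (b p) = 0" if "p \<ge> max N M" for p using zero[OF that] by (simp add: zero_enat_def)
    show "A + C = (\<Sum>p<max N M. (-1) ^ p * int (the_enat (b p)))"
      using long_exact_nat[OF a'(1) b' c'(1), of "max N M"] zero[of "max N M"]
        a'(3)[of "max N M"] c'(3)[of "max N M"] by simp
  qed
qed

lemma long_exact_right:
  assumes "has_alternating_sum a A" "has_alternating_sum b B"
  shows "has_alternating_sum c (B - A)"
proof -
  obtain a' N where a': "\<And>p. a p = enat (a' p)" "\<And>p. p \<ge> N \<Longrightarrow> a' p = 0"
    "\<And>M. M \<ge> N \<Longrightarrow> A = (\<Sum>p<M. (-1) ^ p * int (a' p))"
    using has_alternating_sumE[OF assms(1)] by blast
  obtain b' M where b': "\<And>p. b p = enat (b' p)" "\<And>p. p \<ge> M \<Longrightarrow> b' p = 0"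
    "\<And>L. L \<ge> M \<Longrightarrow> B = (\<Sum>p<L. (-1) ^ p * int (b' p))"
    using has_alternating_sumE[OF assms(2)] by blast
  have d: "\<delta> p \<noteq> \<infinity>" for p
    using a[of "p - 1"] a'(1)[of "p - 1"] 0 plus_eq_infty_iff_enat
    by (cases p) (simp, metis diff_Suc_1 enat.distinct(2))
  have "c p \<noteq> \<infinity>" for p
    using c[of p] b[of p] b'(1)[of p] d[of p] plus_eq_infty_iff_enat
    by (metis enat.distinct(2))
  then have c': "c p = enat (the_enat (c p))" for p by (metis enat_ord_simps(6) the_enat.simps not_infinity_eq)
  \<comment> \<open>\<open>\<delta> p\<close> is controlled by \<open>a\<close> one degree below, hence the shift by one\<close>
  have zero: "c p = 0 \<and> \<delta> p = 0" if "p \<ge> Suc (max N M)" for p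
    using a[of "p - 1"] c[of p] b[of p] a'[of "p - 1"] b'[of p] that
    by (cases p) (auto simp: zero_enat_def[symmetric])
  show ?thesis
  proof (rule has_alternating_sumI[OF c'])
    show "the_enat (c p) = 0" if "p \<ge> Suc (max N M)" for p using zero[OF that] by (simp add: zero_enat_def)
    show "B - A = (\<Sum>p<Suc (max N M). (-1) ^ p * int (the_enat (c p)))"
      using long_exact_nat[OF a'(1) b'(1) c', of "Suc (max N M)"] zero[of "Suc (max N M)"]
        a'(3)[of "Suc (max N M)"] b'(3)[of "Suc (max N M)"] by (simp add: le_SucI del: sum.lessThan_Suc)
  qed
qed

end

section \<open>The Euler characteristic as an additive invariant\<close>

definition has_euler :: "'a topology \<Rightarrow> int \<Rightarrow> bool" where
  "has_euler X c \<longleftrightarrow> has_alternating_sum (\<lambda>p. betti p X) c"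

lemma has_euler_imp:
  assumes "has_euler X c"
  shows "euler_defined X" "euler_characteristic X = c"
proof -
  obtain s N where s: "\<And>p. betti p X = enat (s p)" "\<And>p. p \<ge> N \<Longrightarrow> s p = 0"
    "\<And>M. M \<ge> N \<Longrightarrow> c = (\<Sum>p<M. (-1) ^ p * int (s p))"
    using has_alternating_sumE[OF assms[unfolded has_euler_def]] by blast
  have sub: "{p. betti p X \<noteq> 0} \<subseteq> {..<N}"
    using s(1,2) by (force simp: zero_enat_def not_less[symmetric])
  then show "euler_defined X"
    using s(1) finite_subset by (auto simp: euler_defined_def)
  have "euler_characteristic X = (\<Sum>p<N. (-1) ^ p * int (the_enat (betti p X)))"
    unfolding euler_characteristic_def by (rule sum.mono_neutral_left) (use sub in \<open>auto simp: zero_enat_def\<close>)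
  then show "euler_characteristic X = c" using s(1) s(3)[of N] by simp
qed

abbreviation relative_betti :: "nat \<Rightarrow> 'a topology \<Rightarrow> 'a set \<Rightarrow> enat" where
  "relative_betti p X S \<equiv> abelian_rank (relative_homology_group (int p) X S)"

text \<open>Rank-nullity applied to the three maps of the long exact sequence of the pair, the kernel of each
  being the image of the one before. The boundary map in degree zero lands in the trivial group of
  degree \<open>-1\<close>.\<close>

lemma long_exact_ranks:
  fixes X :: "'a topology" and S :: "'a set"
  obtains \<alpha> \<beta> \<delta> :: "nat \<Rightarrow> enat" where
    "\<And>p. betti p (subtopology X S) = \<delta> (Suc p) + \<alpha> p"
    "\<And>p. betti p X = \<alpha> p + \<beta> p"
    "\<And>p. relative_betti p X S = \<beta> p + \<delta> p"
    "\<delta> 0 = 0"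
proof -
  define i where "i = (\<lambda>p. hom_induced p (subtopology X S) {} X {} id)"
  define j where "j = (\<lambda>p. hom_induced p X {} X S id)"
  define bd where "bd = (\<lambda>p. hom_boundary p X S)"
  define HS where "HS = (\<lambda>p. homology_group p (subtopology X S))"
  define HX where "HX = (\<lambda>p. homology_group p X)"
  define HR where "HR = (\<lambda>p. relative_homology_group p X S)"
  have homs: "i p \<in> hom (HS p) (HX p)" "j p \<in> hom (HX p) (HR p)" "bd p \<in> hom (HR p) (HS (p - 1))" for p
    by (simp_all add: i_def j_def bd_def HS_def HX_def HR_def hom_induced_hom hom_boundary_hom)
  have ab: "comm_group (HS p)" "comm_group (HX p)" "comm_group (HR p)" for p
    by (simp_all add: HS_def HX_def HR_def)
  have ker: "kernel (HR p) (HS (p - 1)) (bd p) = j p ` carrier (HX p)"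
    "kernel (HS (p - 1)) (HX (p - 1)) (i (p - 1)) = bd p ` carrier (HR p)"
    "kernel (HX p) (HR p) (j p) = i p ` carrier (HS p)" for p
    using homology_exactness_axiom_1[of p X S] homology_exactness_axiom_2[of p X S]
      homology_exactness_axiom_3[of p X S]
    by (simp_all add: i_def j_def bd_def HS_def HX_def HR_def)
  have rn: "abelian_rank (HS p) = rank_in (HS p) (kernel (HS p) (HX p) (i p)) + rank_in (HX p) (i p ` carrier (HS p))"
    "abelian_rank (HX p) = rank_in (HX p) (kernel (HX p) (HR p) (j p)) + rank_in (HR p) (j p ` carrier (HX p))"
    "abelian_rank (HR p) = rank_in (HR p) (kernel (HR p) (HS (p - 1)) (bd p)) + rank_in (HS (p - 1)) (bd p ` carrier (HR p))" for p
    using homs ab by (auto intro!: comm_group_hom.rank_nullity simp: comm_group_hom_def comm_group_hom_axioms_def)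
  have triv: "rank_in (HS (-1)) (bd 0 ` carrier (HR 0)) = 0"
  proof -
    have "carrier (HS (-1)) = {\<one>\<^bsub>HS (-1)\<^esub>}"
      using trivial_group_def[of "HS (-1)"] by (simp add: HS_def)
    moreover have "bd 0 ` carrier (HR 0) \<subseteq> carrier (HS (-1))"
      using homs(3)[of 0] by (auto simp: hom_def)
    ultimately have "rank_in (HS (-1)) (bd 0 ` carrier (HR 0)) \<le> 0"
      using rank_in_mono[of "bd 0 ` carrier (HR 0)" "{\<one>\<^bsub>HS (-1)\<^esub>}" "HS (-1)"] rank_in_one[OF ab(1)[of "-1"]]
      by simp
    then show ?thesis by simp
  qed
  have k2: "kernel (HS (int p)) (HX (int p)) (i (int p)) = bd (int (Suc p)) ` carrier (HR (int (Suc p)))" for p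
    using ker(2)[of "int (Suc p)"] by simp
  show ?thesis
  proof (rule that[of "\<lambda>p. rank_in (HS (int p - 1)) (bd (int p) ` carrier (HR (int p)))"
        "\<lambda>p. rank_in (HX (int p)) (i (int p) ` carrier (HS (int p)))"
        "\<lambda>p. rank_in (HR (int p)) (j (int p) ` carrier (HX (int p)))"])
    fix p
    show "betti p (subtopology X S) = rank_in (HS (int (Suc p) - 1)) (bd (int (Suc p)) ` carrier (HR (int (Suc p))))
       + rank_in (HX (int p)) (i (int p) ` carrier (HS (int p)))"
      using rn(1)[of "int p"] k2[of p] by (simp add: betti_def HS_def)
    show "betti p X = rank_in (HX (int p)) (i (int p) ` carrier (HS (int p))) +
        rank_in (HR (int p)) (j (int p) ` carrier (HX (int p)))"
      using rn(2)[of "int p"] ker(3)[of "int p"] by (simp add: betti_def HX_def)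
    show "relative_betti p X S = rank_in (HR (int p)) (j (int p) ` carrier (HX (int p))) +
        rank_in (HS (int p - 1)) (bd (int p) ` carrier (HR (int p)))"
      using rn(3)[of "int p"] ker(1)[of "int p"] by (simp add: HR_def)
  qed (use triv in simp)
qed

lemma has_euler_of_relative:
  assumes "has_euler (subtopology X S) A" "has_alternating_sum (\<lambda>p. relative_betti p X S) C"
  shows "has_euler X (A + C)"
proof -
  obtain \<alpha> \<beta> \<delta> :: "nat \<Rightarrow> enat" where
    "\<And>p. betti p (subtopology X S) = \<delta> (Suc p) + \<alpha> p" "\<And>p. betti p X = \<alpha> p + \<beta> p"
    "\<And>p. relative_betti p X S = \<beta> p + \<delta> p" "\<delta> 0 = 0"
    by (rule long_exact_ranks[of X S]) (rule that)
  from long_exact_middle[of "\<lambda>p. betti p (subtopology X S)" \<delta> \<alpha> "\<lambda>p. betti p X" \<beta>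
      "\<lambda>p. relative_betti p X S", OF this] assms
  show ?thesis by (simp add: has_euler_def)
qed

lemma relative_of_has_euler:
  assumes "has_euler (subtopology X S) A" "has_euler X B"
  shows "has_alternating_sum (\<lambda>p. relative_betti p X S) (B - A)"
proof -
  obtain \<alpha> \<beta> \<delta> :: "nat \<Rightarrow> enat" where
    "\<And>p. betti p (subtopology X S) = \<delta> (Suc p) + \<alpha> p" "\<And>p. betti p X = \<alpha> p + \<beta> p"
    "\<And>p. relative_betti p X S = \<beta> p + \<delta> p" "\<delta> 0 = 0"
    by (rule long_exact_ranks[of X S]) (rule that)
  from long_exact_right[of "\<lambda>p. betti p (subtopology X S)" \<delta> \<alpha> "\<lambda>p. betti p X" \<beta>
      "\<lambda>p. relative_betti p X S", OF this] assms
  show ?thesis by (simp add: has_euler_def)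
qed

text \<open>The relative groups of \<open>(X, U)\<close> and \<open>(W, U \<inter> W)\<close> agree by excising the complement of \<open>W\<close>, which
  is closed and contained in the open set \<open>U\<close>. Comparing the two long exact sequences gives
  inclusion-exclusion.\<close>

lemma has_euler_open_Un:
  assumes U: "openin X U" and W: "openin X W" and cover: "U \<union> W = topspace X"
    and e: "has_euler (subtopology X U) u" "has_euler (subtopology X W) w"
      "has_euler (subtopology X (U \<inter> W)) v"
  shows "has_euler X (u + w - v)"
proof -
  let ?Z = "topspace X - W"
  have sub: "U \<subseteq> topspace X" "W \<subseteq> topspace X" using U W openin_subset by auto
  have "X closure_of ?Z \<subseteq> X interior_of U"
    using W U cover by (auto simp: closure_of_closedin closedin_def interior_of_openin Diff_Diff_Int Int_absorb1 sub)
  then have "hom_induced p (subtopology X (topspace X - ?Z)) (U - ?Z) (subtopology X (topspace X)) U id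
      \<in> iso (relative_homology_group p (subtopology X (topspace X - ?Z)) (U - ?Z))
            (relative_homology_group p (subtopology X (topspace X)) U)" for p
    by (rule homology_excision_axiom) (rule sub)
  moreover have "topspace X - ?Z = W" "U - ?Z = U \<inter> W" using sub by auto
  ultimately have "relative_homology_group p (subtopology X W) (U \<inter> W) \<cong> relative_homology_group p X U" for p
    by (auto simp: is_iso_def)
  then have "relative_betti p (subtopology X W) (U \<inter> W) = relative_betti p X U" for p
    by (intro abelian_rank_iso) auto
  moreover have "has_alternating_sum (\<lambda>p. relative_betti p (subtopology X W) (U \<inter> W)) (w - v)"
    using e by (intro relative_of_has_euler) (simp_all add: subtopology_subtopology Int_absorb1 inf.absorb2 Int_left_absorb inf_commute)
  ultimately have "has_alternating_sum (\<lambda>p. relative_betti p X U) (w - v)" by simp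
  from has_euler_of_relative[OF e(1) this] show ?thesis by (simp add: algebra_simps)
qed

lemma has_euler_homotopy_equivalent:
  assumes "X homotopy_equivalent_space Y" "has_euler Y c" shows "has_euler X c"
proof -
  have "betti p X = betti p Y" for p
    unfolding betti_def
    by (intro abelian_rank_iso homotopy_equivalent_space_imp_isomorphic_homology_groups assms) auto
  with assms(2) show ?thesis by (simp add: has_euler_def)
qed

lemma has_euler_empty: "topspace X = {} \<Longrightarrow> has_euler X 0"
  unfolding has_euler_def
  by (rule has_alternating_sumI[where N = 0 and s = "\<lambda>_. 0"])
    (simp_all add: betti_def abelian_rank_trivial trivial_homology_group_empty zero_enat_def[symmetric])

lemma has_euler_singleton:
  assumes "topspace X = {x}" shows "has_euler X 1"
  unfolding has_euler_def
proof (rule has_alternating_sumI[where N = 1 and s = "\<lambda>p. if p = 0 then 1 else 0"])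
  fix p
  have "abelian_rank (homology_group 0 X) = 1"
    using abelian_rank_iso[OF homology_coefficients[OF assms]]
    by (simp add: abelian_rank_integer_group abelian_integer_group)
  then show "betti p X = enat (if p = 0 then 1 else 0)"
    using homology_dimension_axiom[OF assms, of "int p"]
    by (auto simp: betti_def abelian_rank_trivial zero_enat_def[symmetric] one_enat_def)
qed auto

lemma has_euler_disjoint_open_Union:
  assumes "finite I" "\<And>i. i \<in> I \<Longrightarrow> openin X (W i)" "disjoint_family_on W I"
    and "\<And>i. i \<in> I \<Longrightarrow> has_euler (subtopology X (W i)) (c i)"
  shows "has_euler (subtopology X (\<Union>i\<in>I. W i)) (\<Sum>i\<in>I. c i)"
  using assms
proof (induction I rule: finite_induct)
  case empty
  then show ?case by (simp add: has_euler_empty)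
next
  case (insert i I)
  let ?U = "W i" and ?W = "\<Union>i\<in>I. W i"
  let ?Y = "subtopology X (?U \<union> ?W)"
  have op: "openin X ?U" "openin X ?W" using insert.prems(1) by auto
  have IH: "has_euler (subtopology X ?W) (\<Sum>i\<in>I. c i)"
    using insert by (auto simp: disjoint_family_on_def)
  have dis: "?U \<inter> ?W = {}"
    using insert.prems(2) insert.hyps by (fastforce simp: disjoint_family_on_def)
  have "has_euler ?Y (c i + (\<Sum>i\<in>I. c i) - 0)"
  proof (rule has_euler_open_Un[of _ ?U ?W])
    show "openin ?Y ?U" "openin ?Y ?W"
      using op by (auto simp: openin_open_subtopology openin_Un)
    show "?U \<union> ?W = topspace ?Y" using op[THEN openin_subset] by auto
    show "has_euler (subtopology ?Y ?U) (c i)" using insert.prems(3)[of i]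
      by (simp add: subtopology_subtopology Int_absorb1)
    show "has_euler (subtopology ?Y ?W) (\<Sum>i\<in>I. c i)" using IH
      by (simp add: subtopology_subtopology Int_absorb1)
    show "has_euler (subtopology ?Y (?U \<inter> ?W)) 0" unfolding dis by (simp add: has_euler_empty)
  qed
  then show ?case using insert.hyps by simp
qed

lemma has_euler_finite_discrete:
  assumes "finite D" shows "has_euler (discrete_topology D) (int (card D))"
proof -
  have "has_euler (subtopology (discrete_topology D) (\<Union>x\<in>D. {x})) (\<Sum>x\<in>D. 1)"
    using assms by (intro has_euler_disjoint_open_Union has_euler_singleton) (auto simp: disjoint_family_on_def)
  then show ?thesis by simp
qed

lemma has_euler_prod_contractible:
  assumes "contractible_space Y" "topspace Y \<noteq> {}" "has_euler X c"
  shows "has_euler (prod_topology X Y) c"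
proof (rule has_euler_homotopy_equivalent[OF _ assms(3)])
  obtain a where a: "a \<in> topspace Y" "homotopic_with (\<lambda>x. True) Y Y id (\<lambda>x. a)"
    using assms(1,2) by (auto simp: contractible_space)
  have "homotopic_with (\<lambda>x. True) (prod_topology X Y) (prod_topology X Y)
      (\<lambda>z. (id (fst z), id (snd z))) (\<lambda>z. (id (fst z), a))"
    by (rule homotopic_with_prod_topology[OF _ a(2)]) (auto simp: homotopic_with_refl)
  then have "homotopic_with (\<lambda>x. True) (prod_topology X Y) (prod_topology X Y)
      ((\<lambda>x. (x, a)) \<circ> fst) id"
    by (simp add: homotopic_with_symD o_def id_def)
  moreover have "retraction_maps (prod_topology X Y) X fst (\<lambda>x. (x, a))"
    using a(1) by (auto simp: retraction_maps_def continuous_map_fst continuous_map_pairwise o_def)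
  ultimately show "prod_topology X Y homotopy_equivalent_space X"
    by (rule deformation_retraction_imp_homotopy_equivalent_space)
qed

section \<open>Coordinates on a graph\<close>

lemma subtopology_Collect_topspace:
  "subtopology T {x \<in> topspace T. P x} = subtopology T {x. P x}"
  using subtopology_restrict[of T "{x. P x}"] by (simp add: Int_def)

text \<open>A graph together with a choice of characteristic maps. The choice only serves to describe
  coordinates on the edges.\<close>

locale parametrized_graph =
  fixes X :: "'a topology" and V :: "'a set" and E :: "'a set set" and \<phi> :: "'a set \<Rightarrow> real \<Rightarrow> 'a"
  assumes graph: "CW_graph X V E"
    and char_map: "\<And>e. e \<in> E \<Longrightarrow> characteristic_map X V e (\<phi> e)"
begin

lemma Hausdorff: "Hausdorff_space X" and compact: "compact_space X"
  and V_sub: "V \<subseteq> topspace X" and Union_E: "\<Union>E = topspace X - V" and disj_E: "disjoint E"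
  using graph by (auto simp: CW_graph_def one_dim_CW_complex_def partition_on_def)

lemma weak_topology: "A \<subseteq> topspace X \<Longrightarrow> (\<And>e. e \<in> E \<Longrightarrow> closedin X (A \<inter> X closure_of e)) \<Longrightarrow> closedin X A"
  using graph by (auto simp: CW_graph_def one_dim_CW_complex_def)

lemma edge_unique: "e \<in> E \<Longrightarrow> e' \<in> E \<Longrightarrow> x \<in> e \<Longrightarrow> x \<in> e' \<Longrightarrow> e = e'"
  using disj_E by (auto simp: disjoint_def)

lemma edge_sub: "e \<in> E \<Longrightarrow> e \<subseteq> topspace X - V"
  using Union_E by auto

lemma continuous_phi: "e \<in> E \<Longrightarrow> continuous_map (top_of_set {0..1}) X (\<phi> e)"
  and phi_ends: "e \<in> E \<Longrightarrow> \<phi> e 0 \<in> V" "e \<in> E \<Longrightarrow> \<phi> e 1 \<in> V"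
  using char_map by (auto simp: characteristic_map_def)

lemma homeo_phi: "e \<in> E \<Longrightarrow> homeomorphic_map (top_of_set {0<..<1}) (subtopology X e) (\<phi> e)"
  using char_map by (auto simp: characteristic_map_def)

lemma phi_image: "e \<in> E \<Longrightarrow> \<phi> e ` {0<..<1} = e"
  using homeomorphic_imp_surjective_map[OF homeo_phi[of e]] edge_sub[of e] by auto

lemma phi_inj: "e \<in> E \<Longrightarrow> inj_on (\<phi> e) {0<..<1}"
  using homeomorphic_imp_injective_map[OF homeo_phi[of e]] by simp

lemma phi_in_edge: "e \<in> E \<Longrightarrow> 0 < t \<Longrightarrow> t < 1 \<Longrightarrow> \<phi> e t \<in> e"
  using phi_image[of e] by auto

lemma phi_in_V_iff:
  assumes "e \<in> E" "0 \<le> t" "t \<le> 1" shows "\<phi> e t \<in> V \<longleftrightarrow> t = 0 \<or> t = 1"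
proof (cases "t = 0 \<or> t = 1")
  case True
  with phi_ends[OF assms(1)] show ?thesis by auto
next
  case False
  with assms have "\<phi> e t \<in> e" by (intro phi_in_edge) auto
  with False edge_sub[OF assms(1)] show ?thesis by auto
qed

lemma closedin_phi: "e \<in> E \<Longrightarrow> 0 \<le> a \<Longrightarrow> b \<le> 1 \<Longrightarrow> closedin X (\<phi> e ` {a..b})"
  by (rule compactin_imp_closedin[OF Hausdorff], rule image_compactin[OF _ continuous_phi])
    (auto simp: compactin_subtopology)

lemma closure_edge_subset:
  assumes "e \<in> E" shows "X closure_of e \<subseteq> e \<union> \<phi> e ` {0, 1}"
proof -
  have "X closure_of e \<subseteq> \<phi> e ` {0..1}"
  proof (rule closure_of_minimal)
    have "\<phi> e ` {0<..<1} \<subseteq> \<phi> e ` {0..1}" by (rule image_mono) auto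
    then show "e \<subseteq> \<phi> e ` {0..1}" by (simp only: phi_image[OF assms])
  qed (simp add: closedin_phi assms)
  also have "{0..1} = {0<..<1} \<union> {0, 1::real}" by auto
  finally show ?thesis by (simp add: image_Un phi_image[OF assms])
qed

lemma closure_edge_disjoint:
  assumes "e \<in> E" "e' \<in> E" "e \<noteq> e'" shows "X closure_of e \<inter> e' = {}"
  using closure_edge_subset[OF assms(1)] phi_ends[OF assms(1)] edge_sub[OF assms(2)] assms edge_unique
  by fastforce

text \<open>By the weak topology every subset of such a set is closed, so it is a closed discrete subset of a
  compact space. This yields the finiteness of the vertex set and, applied to the midpoints, of the
  edge set.\<close>

lemma sparse_imp_finite:
  assumes sub: "A \<subseteq> topspace X" and sparse: "\<And>e. e \<in> E \<Longrightarrow> finite (A \<inter> X closure_of e)"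
  shows "finite A"
proof -
  have closed: "closedin X B" if "B \<subseteq> A" for B
  proof (rule weak_topology)
    show "B \<subseteq> topspace X" using that sub by blast
    fix e assume "e \<in> E"
    then have "finite (B \<inter> X closure_of e)"
      using that by (intro finite_subset[OF _ sparse]) auto
    then show "closedin X (B \<inter> X closure_of e)"
      using that sub by (intro closedin_Hausdorff_finite Hausdorff) auto
  qed
  have "openin (subtopology X A) {x}" if "x \<in> A" for x
  proof -
    have "closedin (subtopology X A) (A - {x})"
      using closed[of "A - {x}"] by (auto simp: closedin_subset_topspace)
    then show ?thesis using that sub
      by (auto simp: closedin_def Int_absorb1 Diff_Diff_Int insert_absorb)
  qed
  then have "discrete_topology A = subtopology X A"
    using sub by (auto simp: discrete_topology_unique)
  moreover have "compact_space (subtopology X A)"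
    using closedin_compact_space[OF compact closed[of A]] by (simp add: compact_space_subtopology)
  ultimately show ?thesis by (metis compact_space_discrete_topology)
qed

lemma finite_V: "finite V"
proof (rule sparse_imp_finite[OF V_sub])
  fix e assume e: "e \<in> E"
  then have "V \<inter> X closure_of e \<subseteq> \<phi> e ` {0, 1}"
    using closure_edge_subset[OF e] edge_sub[OF e] by auto
  then show "finite (V \<inter> X closure_of e)" by (rule finite_subset) simp
qed

definition edge_mid :: "'a set \<Rightarrow> 'a" where
  "edge_mid e = \<phi> e (1/2)"

lemma edge_mid_in: "e \<in> E \<Longrightarrow> edge_mid e \<in> e"
  by (simp add: edge_mid_def phi_in_edge)

lemma edge_mid_in_iff: "e \<in> E \<Longrightarrow> e' \<in> E \<Longrightarrow> edge_mid e \<in> e' \<longleftrightarrow> e = e'"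
  using edge_mid_in edge_unique by blast

lemma finite_E: "finite E"
proof -
  have "finite (edge_mid ` E)"
  proof (rule sparse_imp_finite)
    show "edge_mid ` E \<subseteq> topspace X" using edge_mid_in edge_sub by blast
    fix e assume e: "e \<in> E"
    have "edge_mid ` E \<inter> X closure_of e \<subseteq> {edge_mid e}"
      using closure_edge_disjoint[OF e] edge_mid_in by fastforce
    then show "finite (edge_mid ` E \<inter> X closure_of e)" by (rule finite_subset) simp
  qed
  moreover have "inj_on edge_mid E" using edge_mid_in_iff edge_mid_in by (metis inj_onI)
  ultimately show ?thesis by (rule finite_imageD)
qed

lemma edge_open:
  assumes "e \<in> E" shows "openin X e"
proof -
  have "closedin X (topspace X - e)"
  proof (rule weak_topology)
    fix e' assume e': "e' \<in> E"
    show "closedin X ((topspace X - e) \<inter> X closure_of e')"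
    proof (cases "e' = e")
      case True
      have "(topspace X - e) \<inter> X closure_of e' \<subseteq> \<phi> e ` {0, 1}"
        using closure_edge_subset[OF assms] True by auto
      then have "finite ((topspace X - e) \<inter> X closure_of e')" by (rule finite_subset) simp
      then show ?thesis by (intro closedin_Hausdorff_finite Hausdorff) auto
    next
      case False
      then have "(topspace X - e) \<inter> X closure_of e' = X closure_of e'"
        using closure_edge_disjoint[OF e' assms] closure_of_subset_topspace[of X e'] by auto
      then show ?thesis by simp
    qed
  qed auto
  then show ?thesis using edge_sub[OF assms] by (simp add: openin_closedin_eq subset_iff)
qed

definition coord :: "'a set \<Rightarrow> 'a \<Rightarrow> real" where
  "coord e = inv_into {0<..<1} (\<phi> e)"

lemma coord_phi: "e \<in> E \<Longrightarrow> 0 < t \<Longrightarrow> t < 1 \<Longrightarrow> coord e (\<phi> e t) = t"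
  unfolding coord_def by (rule inv_into_f_f[OF phi_inj]) auto

lemma phi_coord: "e \<in> E \<Longrightarrow> x \<in> e \<Longrightarrow> \<phi> e (coord e x) = x"
  and coord_bounds: "e \<in> E \<Longrightarrow> x \<in> e \<Longrightarrow> 0 < coord e x \<and> coord e x < 1"
  unfolding coord_def using phi_image[of e] f_inv_into_f[of x "\<phi> e" "{0<..<1}"]
    inv_into_into[of x "\<phi> e" "{0<..<1}"] by auto

lemma coord_edge_mid: "e \<in> E \<Longrightarrow> coord e (edge_mid e) = 1/2"
  by (simp add: edge_mid_def coord_phi)

lemma coord_eq_half_iff: "e \<in> E \<Longrightarrow> x \<in> e \<Longrightarrow> coord e x = 1/2 \<longleftrightarrow> x = edge_mid e"
  using phi_coord[of e x] coord_edge_mid[of e] by (metis edge_mid_def)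

lemma continuous_coord:
  assumes "e \<in> E" shows "continuous_map (subtopology X e) euclideanreal (coord e)"
proof -
  obtain g where g: "homeomorphic_maps (top_of_set {0<..<1}) (subtopology X e) (\<phi> e) g"
    using homeo_phi[OF assms] homeomorphic_map_maps by blast
  then have "continuous_map (subtopology X e) euclideanreal g"
    by (auto simp: homeomorphic_maps_def continuous_map_in_subtopology)
  moreover have "g x = coord e x" if "x \<in> topspace (subtopology X e)" for x
  proof -
    have x: "x \<in> e" using that by simp
    have "g (\<phi> e (coord e x)) = coord e x"
      using g coord_bounds[OF assms x] by (auto simp: homeomorphic_maps_def)
    then show ?thesis by (simp add: phi_coord[OF assms x])
  qed
  ultimately show ?thesis by (rule continuous_map_eq)
qed

text \<open>The distance to the midpoint of an edge, continued by the constant \<open>1/2\<close> outside the edge. The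
  coordinate itself cannot be used on the whole graph: on a loop it tends to both \<open>0\<close> and \<open>1\<close> at the
  same vertex, while the distance tends to \<open>1/2\<close> either way.\<close>

definition gap :: "'a set \<Rightarrow> 'a \<Rightarrow> real" where
  "gap e x = (if x \<in> e then \<bar>coord e x - 1/2\<bar> else 1/2)"

lemma gap_bounds: "e \<in> E \<Longrightarrow> 0 \<le> gap e x" "e \<in> E \<Longrightarrow> gap e x \<le> 1/2"
  using coord_bounds[of e x] by (auto simp: gap_def abs_if)

lemma gap_eq_0_iff: "e \<in> E \<Longrightarrow> gap e x = 0 \<longleftrightarrow> x = edge_mid e"
  using coord_eq_half_iff[of e x] edge_mid_in[of e] by (auto simp: gap_def)

text \<open>Strict sublevel sets are open because an edge is an open subset; weak sublevel sets below \<open>1/2\<close>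
  are images of compact intervals, hence closed.\<close>

lemma continuous_gap:
  assumes e: "e \<in> E" shows "continuous_map X euclideanreal (gap e)"
  unfolding continuous_map_upper_lower_semicontinuous_lte
proof (intro conjI allI)
  fix a :: real
  show "openin X {x \<in> topspace X. gap e x < a}"
  proof (cases "a > 1/2")
    case True
    then have "{x \<in> topspace X. gap e x < a} = topspace X"
      using le_less_trans[OF gap_bounds(2)[OF e]] by blast
    then show ?thesis by simp
  next
    case False
    then have "{x \<in> topspace X. gap e x < a} = {x \<in> topspace (subtopology X e). \<bar>coord e x - 1/2\<bar> \<in> {..<a}}"
      using edge_sub[OF e] by (auto simp: gap_def split: if_splits)
    moreover have "openin (subtopology X e) {x \<in> topspace (subtopology X e). \<bar>coord e x - 1/2\<bar> \<in> {..<a}}"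
      by (rule openin_continuous_map_preimage[where Y = euclideanreal])
        (auto intro!: continuous_intros continuous_coord[OF e])
    ultimately show ?thesis using edge_open[OF e] by (auto intro: openin_trans_full)
  qed
  show "closedin X {x \<in> topspace X. gap e x \<le> a}"
  proof (cases "a \<ge> 1/2 \<or> a < 0")
    case True
    then show ?thesis
    proof
      assume "a \<ge> 1/2"
      then have "{x \<in> topspace X. gap e x \<le> a} = topspace X"
        using order_trans[OF gap_bounds(2)[OF e]] by blast
      then show ?thesis by simp
    next
      assume "a < 0"
      then have "{x \<in> topspace X. gap e x \<le> a} = {}"
        using less_le_trans[OF _ gap_bounds(1)[OF e]] by (auto simp: not_le)
      then show ?thesis by (simp del: Collect_empty_eq)
    qed
  next
    case False
    have "{x \<in> topspace X. gap e x \<le> a} = \<phi> e ` {1/2 - a..1/2 + a}" (is "?L = ?R")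
    proof (rule equalityI; rule subsetI)
      fix x assume "x \<in> ?L"
      then have x: "x \<in> e" "\<bar>coord e x - 1/2\<bar> \<le> a" using False by (auto simp: gap_def split: if_splits)
      then have "coord e x \<in> {1/2 - a..1/2 + a}" by (auto simp: abs_le_iff)
      then show "x \<in> ?R" using phi_coord[OF e x(1)] by (metis imageI)
    next
      fix x assume "x \<in> ?R"
      then obtain t where t: "x = \<phi> e t" "1/2 - a \<le> t" "t \<le> 1/2 + a" by auto
      then have "0 < t" "t < 1" using False by auto
      then show "x \<in> ?L" using t phi_in_edge[OF e, of t] edge_sub[OF e] coord_phi[OF e, of t]
        by (auto simp: gap_def abs_le_iff)
    qed
    then show ?thesis using closedin_phi[OF e, of "1/2 - a" "1/2 + a"] False by simp
  qed
qed

section \<open>Collapsing the punctured graph onto its vertices\<close>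

text \<open>The two halves of the unit interval shrink towards the end points \<open>0\<close> and \<open>1\<close> as \<open>s\<close> runs from \<open>0\<close>
  to \<open>1\<close>. The formula jumps at \<open>t = 1/2\<close>, which is why the midpoints have to be
  removed from the graph.\<close>

definition squeeze :: "real \<Rightarrow> real \<Rightarrow> real" where
  "squeeze s t = (if t < 1/2 then (1 - s) * t else 1 - (1 - s) * (1 - t))"

definition edge_of :: "'a \<Rightarrow> 'a set" where
  "edge_of x = (THE e. e \<in> E \<and> x \<in> e)"

definition collapse :: "real \<Rightarrow> 'a \<Rightarrow> 'a" where
  "collapse s x = (if x \<in> V then x else \<phi> (edge_of x) (squeeze s (coord (edge_of x) x)))"

lemma edge_of_eq: "e \<in> E \<Longrightarrow> x \<in> e \<Longrightarrow> edge_of x = e"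
  unfolding edge_of_def using edge_unique by (intro the_equality) auto

lemma point_cases:
  assumes "x \<in> topspace X"
  obtains "x \<in> V" | e t where "e \<in> E" "x \<in> e" "0 < t" "t < 1" "x = \<phi> e t"
proof (cases "x \<in> V")
  case False
  with assms Union_E obtain e where e: "e \<in> E" "x \<in> e" by blast
  show ?thesis using that(2)[OF e, of "coord e x"] coord_bounds[OF e] phi_coord[OF e] by auto
qed (use that in blast)

lemma collapse_V: "x \<in> V \<Longrightarrow> collapse s x = x"
  by (simp add: collapse_def)

lemma collapse_phi_open:
  assumes "e \<in> E" "0 < t" "t < 1" shows "collapse s (\<phi> e t) = \<phi> e (squeeze s t)"
proof -
  have "\<phi> e t \<in> e" using assms by (rule phi_in_edge)
  then show ?thesis
    using assms edge_sub[of e] by (auto simp: collapse_def edge_of_eq coord_phi)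
qed

lemma collapse_phi:
  assumes "e \<in> E" "0 \<le> t" "t \<le> 1" shows "collapse s (\<phi> e t) = \<phi> e (squeeze s t)"
proof -
  consider "t = 0" | "t = 1" | "0 < t" "t < 1" using assms by linarith
  then show ?thesis
  proof cases
    case 3
    with assms(1) show ?thesis by (intro collapse_phi_open)
  qed (use phi_ends[OF assms(1)] in \<open>auto simp: collapse_V squeeze_def\<close>)
qed

lemma squeeze_bounds: "0 \<le> s \<Longrightarrow> s \<le> 1 \<Longrightarrow> 0 \<le> t \<Longrightarrow> t \<le> 1 \<Longrightarrow> 0 \<le> squeeze s t \<and> squeeze s t \<le> 1"
  by (auto simp: squeeze_def mult_le_one)

lemma squeeze_half:
  assumes "0 \<le> s" "s < 1" "0 < t" "t < 1"
  shows "t < 1/2 \<Longrightarrow> 0 < squeeze s t \<and> squeeze s t < 1/2"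
    and "1/2 < t \<Longrightarrow> 1/2 < squeeze s t \<and> squeeze s t < 1"
proof -
  have *: "(1 - s) * t \<le> t" "(1 - s) * (1 - t) \<le> 1 - t" "0 < (1 - s) * t" "0 < (1 - s) * (1 - t)"
    using assms by (auto simp: mult_left_le_one_le)
  show "0 < squeeze s t \<and> squeeze s t < 1/2" if "t < 1/2"
  proof -
    have "squeeze s t = (1 - s) * t" using that by (simp add: squeeze_def)
    with * that show ?thesis by linarith
  qed
  show "1/2 < squeeze s t \<and> squeeze s t < 1" if "1/2 < t"
  proof -
    have "squeeze s t = 1 - (1 - s) * (1 - t)" using that by (simp add: squeeze_def)
    with * that show ?thesis by linarith
  qed
qed

lemma squeeze_strict_bounds:
  assumes "0 \<le> s" "s < 1" "0 < t" "t < 1" "t \<noteq> 1/2" shows "0 < squeeze s t" "squeeze s t < 1"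
  using squeeze_half[OF assms(1-4)] assms(5) by linarith+

lemma squeeze_lt_half:
  assumes "0 \<le> s" "s < 1" "0 < t" "t < 1" "t \<noteq> 1/2"
  shows "squeeze s t < 1/2 \<longleftrightarrow> t < 1/2" "squeeze s t \<noteq> 1/2"
  using squeeze_half[OF assms(1-4)] assms(5) by linarith+

lemma squeeze_inj:
  assumes "0 \<le> s" "s < 1" "0 < t" "t < 1" "t \<noteq> 1/2" "0 < u" "u < 1" "u \<noteq> 1/2" "squeeze s t = squeeze s u"
  shows "t = u"
proof -
  have "t < 1/2 \<longleftrightarrow> u < 1/2"
    using squeeze_lt_half(1)[of s t] squeeze_lt_half(1)[of s u] assms by simp
  then show ?thesis using assms by (auto simp: squeeze_def split: if_splits)
qed

abbreviation punctured :: "'a topology" where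
  "punctured \<equiv> subtopology X (topspace X - edge_mid ` E)"

lemma phi_in_punctured:
  assumes "e \<in> E" "\<phi> e t \<in> topspace punctured" shows "t \<noteq> 1/2"
proof
  assume "t = 1/2"
  then have "\<phi> e t = edge_mid e" by (simp only: edge_mid_def)
  with assms show False by simp
qed

lemma collapse_0: "x \<in> topspace X \<Longrightarrow> collapse 0 x = x"
  by (erule point_cases) (auto simp: collapse_V collapse_phi_open squeeze_def)

lemma collapse_1: "x \<in> topspace X \<Longrightarrow> collapse 1 x \<in> V"
  by (erule point_cases) (auto simp: collapse_V collapse_phi_open squeeze_def phi_ends)

text \<open>This is what makes the collapse compatible with the collision rule: before time \<open>1\<close> distinct
  particles stay distinct, and at time \<open>1\<close> all of them are on vertices, where collisions are
  allowed.\<close>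

lemma collapse_inj:
  assumes s: "0 \<le> s" "s < 1" and x: "x \<in> topspace punctured" "y \<in> topspace punctured"
    and eq: "collapse s x = collapse s y"
  shows "x = y"
proof -
  have *: "x = y" if y: "y \<in> V" and eq: "collapse s x = collapse s y" and x: "x \<in> topspace punctured" for x y
  proof (rule point_cases[of x])
    fix e t assume t: "e \<in> E" "0 < t" "t < 1" "x = \<phi> e t"
    have "t \<noteq> 1/2" using x t phi_in_punctured by blast
    note bounds = squeeze_strict_bounds[OF s t(2,3) this]
    have "collapse s x \<in> V" using eq y by (simp add: collapse_V)
    then show ?thesis
      using t collapse_phi_open[of e t s] phi_in_V_iff[of e "squeeze s t"] bounds
      by auto
  qed (use x y eq in \<open>auto simp: collapse_V\<close>)
  show ?thesis
  proof (rule point_cases[of x])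
    show "x \<in> topspace X" using x by simp
    assume "x \<in> V" with *[of x y] eq x show ?thesis by simp
  next
    fix e t assume t: "e \<in> E" "0 < t" "t < 1" "x = \<phi> e t"
    show ?thesis
    proof (rule point_cases[of y])
      show "y \<in> topspace X" using x by simp
      assume "y \<in> V" with *[of y x] eq x show ?thesis by simp
    next
      fix e' u assume u: "e' \<in> E" "0 < u" "u < 1" "y = \<phi> e' u"
      have eq': "\<phi> e (squeeze s t) = \<phi> e' (squeeze s u)"
        using eq t u by (simp add: collapse_phi_open)
      have half: "t \<noteq> 1/2" "u \<noteq> 1/2"
        using x t u phi_in_punctured by blast+
      have "e = e'"
        using phi_in_edge[OF t(1) squeeze_strict_bounds[OF s t(2,3) half(1)]]
          phi_in_edge[OF u(1) squeeze_strict_bounds[OF s u(2,3) half(2)]] eq' t u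
        by (intro edge_unique) auto
      then have "squeeze s t = squeeze s u"
        using eq' coord_phi[OF t(1) squeeze_strict_bounds[OF s t(2,3) half(1)]]
          coord_phi[OF u(1) squeeze_strict_bounds[OF s u(2,3) half(2)]] by metis
      then show ?thesis using squeeze_inj[OF s t(2,3) half(1) u(2,3) half(2)] t u \<open>e = e'\<close> by simp
    qed
  qed
qed

lemma collapse_in_punctured:
  assumes s: "0 \<le> s" "s \<le> 1" and x: "x \<in> topspace punctured"
  shows "collapse s x \<in> topspace punctured"
proof (cases "s = 1")
  case True
  have "V \<inter> edge_mid ` E = {}" using edge_mid_in edge_sub by blast
  then show ?thesis using collapse_1[of x] x True V_sub by auto
next
  case False
  with s have s: "0 \<le> s" "s < 1" by auto
  show ?thesis
  proof (rule point_cases[of x])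
    fix e t assume t: "e \<in> E" "0 < t" "t < 1" "x = \<phi> e t"
    have half: "t \<noteq> 1/2" using x t phi_in_punctured by blast
    then have "squeeze s t \<noteq> 1/2" using squeeze_lt_half(2)[OF s t(2,3)] by blast
    moreover have ine: "\<phi> e (squeeze s t) \<in> e" "coord e (\<phi> e (squeeze s t)) = squeeze s t"
      using squeeze_strict_bounds[OF s t(2,3) half] t by (auto intro: phi_in_edge coord_phi)
    ultimately have "\<phi> e (squeeze s t) \<noteq> edge_mid e" using coord_edge_mid[OF t(1)] by auto
    then have "\<phi> e (squeeze s t) \<notin> edge_mid ` E"
      using ine(1) t(1) edge_mid_in_iff by auto
    then show ?thesis using t ine(1) edge_sub[OF t(1)] by (auto simp: collapse_phi_open)
  qed (use x in \<open>auto simp: collapse_V\<close>)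
qed

text \<open>A closed interval of length less than one embeds into the graph, as it is compact and cannot contain
  both ends of a loop. Hence on its image the coordinate is continuous and the collapse is given by a
  formula.\<close>

lemma continuous_collapse_half:
  assumes e: "e \<in> E" and J: "0 \<le> a" "b \<le> 1" "b - a < 1"
    and q: "continuous_map (prod_topology (top_of_set {0..1}) (top_of_set {a..b})) euclideanreal (\<lambda>(s, t). q s t)"
    and sq: "\<And>s t. a \<le> t \<Longrightarrow> t \<le> b \<Longrightarrow> t \<noteq> 1/2 \<Longrightarrow> squeeze s t = q s t"
  shows "continuous_map (subtopology (prod_topology (top_of_set {0..1}) punctured)
      {z. snd z \<in> \<phi> e ` {a..b}}) X (\<lambda>(s, x). collapse s x)" (is "continuous_map ?Z X _")
proof -
  let ?K = "\<phi> e ` {a..b}"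
  have contJ: "continuous_map (top_of_set {a..b}) (subtopology X ?K) (\<phi> e)"
    using continuous_map_from_subtopology_mono[OF continuous_phi[OF e], of "{a..b}"] J
    by (auto simp: continuous_map_in_subtopology)
  have inj: "inj_on (\<phi> e) {a..b}"
  proof (rule inj_onI)
    fix t u assume tu: "t \<in> {a..b}" "u \<in> {a..b}" "\<phi> e t = \<phi> e u"
    show "t = u"
    proof (cases "\<phi> e t \<in> V")
      case True
      then have "t = 0 \<or> t = 1" "u = 0 \<or> u = 1"
        using tu J phi_in_V_iff[OF e, of t] phi_in_V_iff[OF e, of u] by auto
      then show ?thesis using tu J by auto
    next
      case False
      then have "t \<noteq> 0" "t \<noteq> 1" "u \<noteq> 0" "u \<noteq> 1" using phi_ends[OF e] tu by auto
      then show ?thesis using tu J by (intro inj_onD[OF phi_inj[OF e]]) auto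
    qed
  qed
  have subK: "?K \<subseteq> topspace X"
    using closedin_subset[OF closedin_phi[OF e J(1,2)]] .
  have "homeomorphic_map (top_of_set {a..b}) (subtopology X ?K) (\<phi> e)"
    using contJ inj subK
    by (intro continuous_imp_homeomorphic_map Hausdorff_space_subtopology Hausdorff)
      (auto simp: compact_space_subtopology)
  then obtain \<psi> where \<psi>: "homeomorphic_maps (top_of_set {a..b}) (subtopology X ?K) (\<phi> e) \<psi>"
    using homeomorphic_map_maps by blast
  have cont\<psi>: "continuous_map (subtopology X ?K) (top_of_set {a..b}) \<psi>"
    and \<psi>\<phi>: "\<And>t. t \<in> {a..b} \<Longrightarrow> \<psi> (\<phi> e t) = t"
    using \<psi> by (auto simp: homeomorphic_maps_def)
  have fst: "continuous_map ?Z (top_of_set {0..1}) fst"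
    by (intro continuous_map_from_subtopology continuous_map_fst)
  have "continuous_map ?Z punctured snd"
    by (intro continuous_map_from_subtopology continuous_map_snd)
  then have "continuous_map ?Z (subtopology X ?K) snd"
    by (auto simp: continuous_map_in_subtopology)
  from continuous_map_compose[OF this cont\<psi>]
  have snd: "continuous_map ?Z (top_of_set {a..b}) (\<lambda>z. \<psi> (snd z))" by (simp add: o_def)
  have "continuous_map ?Z (prod_topology (top_of_set {0..1}) (top_of_set {a..b})) (\<lambda>z. (fst z, \<psi> (snd z)))"
    unfolding continuous_map_pairwise o_def using fst snd by simp
  from continuous_map_compose[OF this q]
  have cq: "continuous_map ?Z euclideanreal (\<lambda>z. q (fst z) (\<psi> (snd z)))" by (simp add: o_def)
  have val: "q (fst z) (\<psi> (snd z)) \<in> {0..1}" "\<phi> e (q (fst z) (\<psi> (snd z))) = collapse (fst z) (snd z)"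
    if z: "z \<in> topspace ?Z" for z
  proof -
    obtain s t where st: "z = (s, \<phi> e t)" "t \<in> {a..b}" "0 \<le> s" "s \<le> 1" "\<phi> e t \<notin> edge_mid ` E"
      using z by (cases z) auto
    have "t \<noteq> 1/2" using st(5) e by (metis imageI edge_mid_def)
    then have "squeeze s t = q s t" using sq st(2) by auto
    moreover have "0 \<le> t" "t \<le> 1" using st J by auto
    ultimately show "q (fst z) (\<psi> (snd z)) \<in> {0..1}"
      "\<phi> e (q (fst z) (\<psi> (snd z))) = collapse (fst z) (snd z)"
      using st \<psi>\<phi>[OF st(2)] squeeze_bounds[of s t] collapse_phi[OF e, of t s] by auto
  qed
  have "continuous_map ?Z (top_of_set {0..1}) (\<lambda>z. q (fst z) (\<psi> (snd z)))"
    by (rule continuous_map_into_subtopology[OF cq]) (use val(1) in blast)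
  from continuous_map_compose[OF this continuous_phi[OF e]]
  show ?thesis
    by (rule continuous_map_eq) (use val(2) in \<open>auto simp: case_prod_beta\<close>)
qed

text \<open>The punctured graph is covered by finitely many closed pieces: the vertex set, on which nothing
  moves, and the two closed halves of each edge.\<close>

lemma continuous_collapse:
  "continuous_map (prod_topology (top_of_set {0..1}) punctured) punctured (\<lambda>(s, x). collapse s x)"
    (is "continuous_map ?Z _ _")
proof -
  define \<K> where "\<K> = insert V ((\<lambda>e. \<phi> e ` {0..1/2}) ` E \<union> (\<lambda>e. \<phi> e ` {1/2..1}) ` E)"
  have "continuous_map ?Z X (\<lambda>(s, x). collapse s x)"
  proof (rule pasting_lemma_closed[where I = \<K> and T = "\<lambda>K. {z \<in> topspace ?Z. snd z \<in> K}"
        and f = "\<lambda>_ (s, x). collapse s x"])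
    show "finite \<K>" using finite_E by (simp add: \<K>_def)
    fix K assume K: "K \<in> \<K>"
    have "closedin X V" by (rule closedin_Hausdorff_finite[OF Hausdorff V_sub finite_V])
    then have "closedin X K" using K by (auto simp: \<K>_def intro: closedin_phi)
    then show "closedin ?Z {z \<in> topspace ?Z. snd z \<in> K}"
      by (intro closedin_continuous_map_preimage[where Y = X])
        (auto intro: continuous_map_into_fulltopology[OF continuous_map_snd])
    have eq: "subtopology ?Z {z \<in> topspace ?Z. snd z \<in> K} = subtopology ?Z {z. snd z \<in> K}"
      by (rule subtopology_Collect_topspace)
    from K consider "K = V" | e where "e \<in> E" "K = \<phi> e ` {0..1/2}" | e where "e \<in> E" "K = \<phi> e ` {1/2..1}"
      unfolding \<K>_def by blast
    then show "continuous_map (subtopology ?Z {z \<in> topspace ?Z. snd z \<in> K}) X (\<lambda>(s, x). collapse s x)"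
      unfolding eq
    proof cases
      case 1
      have "continuous_map (subtopology ?Z {z. snd z \<in> K}) X snd"
        by (intro continuous_map_from_subtopology continuous_map_into_fulltopology[OF continuous_map_snd])
      then show "continuous_map (subtopology ?Z {z. snd z \<in> K}) X (\<lambda>(s, x). collapse s x)"
        by (rule continuous_map_eq) (auto simp: 1 collapse_V)
    next
      case 2
      have "continuous_map (prod_topology (top_of_set {0..1}) (top_of_set {0..1/2})) euclideanreal
          (\<lambda>(s, t). (1 - s) * t)"
        unfolding case_prod_beta
        by (intro continuous_intros continuous_map_into_fulltopology[OF continuous_map_fst]
            continuous_map_into_fulltopology[OF continuous_map_snd]) auto
      from continuous_collapse_half[OF 2(1) _ _ _ this]
      show "continuous_map (subtopology ?Z {z. snd z \<in> K}) X (\<lambda>(s, x). collapse s x)"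
        unfolding 2(2) by (simp add: squeeze_def)
    next
      case 3
      have "continuous_map (prod_topology (top_of_set {0..1}) (top_of_set {1/2..1})) euclideanreal
          (\<lambda>(s, t). 1 - (1 - s) * (1 - t))"
        unfolding case_prod_beta
        by (intro continuous_intros continuous_map_into_fulltopology[OF continuous_map_fst]
            continuous_map_into_fulltopology[OF continuous_map_snd]) auto
      from continuous_collapse_half[OF 3(1) _ _ _ this]
      show "continuous_map (subtopology ?Z {z. snd z \<in> K}) X (\<lambda>(s, x). collapse s x)"
        unfolding 3(2) by (simp add: squeeze_def)
    qed
  next
    fix z assume z: "z \<in> topspace ?Z"
    then have "snd z \<in> topspace X" by auto
    then have "\<exists>K\<in>\<K>. snd z \<in> K"
    proof (cases rule: point_cases)
      case (2 e t)
      then have "snd z \<in> \<phi> e ` {0..1/2} \<or> snd z \<in> \<phi> e ` {1/2..1}" by (cases "t \<le> 1/2") auto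
      then show ?thesis using 2(1) by (auto simp: \<K>_def)
    qed (auto simp: \<K>_def)
    then show "\<exists>K. K \<in> \<K> \<and> z \<in> {z \<in> topspace ?Z. snd z \<in> K} \<and>
        (case z of (s, x) \<Rightarrow> collapse s x) = (case z of (s, x) \<Rightarrow> collapse s x)"
      using z by blast
  qed simp
  then show ?thesis
    by (rule continuous_map_into_subtopology) (use collapse_in_punctured in force)
qed

end

section \<open>Configurations avoiding the midpoints of some edges\<close>

context parametrized_graph
begin

text \<open>Particles are labelled by an arbitrary index set, so that one of them can be deleted, and may not sit
  at the midpoints of the edges in \<open>S\<close>. The set \<open>S\<close> is the induction parameter: for \<open>S = {}\<close> this is the
  sink configuration space, and for \<open>S = E\<close> it collapses to the maps from \<open>I\<close> to \<open>V\<close>.\<close>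

definition conf :: "nat set \<Rightarrow> 'a set set \<Rightarrow> (nat \<Rightarrow> 'a) topology" where
  "conf I S = subtopology (product_topology (\<lambda>_. X) I)
     {x. (\<forall>i\<in>I. x i \<notin> edge_mid ` S) \<and> (\<forall>i\<in>I. \<forall>j\<in>I. i \<noteq> j \<longrightarrow> x i \<noteq> x j \<or> x i \<in> V)}"

lemma topspace_conf_iff:
  "x \<in> topspace (conf I S) \<longleftrightarrow> x \<in> I \<rightarrow>\<^sub>E topspace X \<and> (\<forall>i\<in>I. x i \<notin> edge_mid ` S) \<and>
     (\<forall>i\<in>I. \<forall>j\<in>I. i \<noteq> j \<longrightarrow> x i \<noteq> x j \<or> x i \<in> V)"
  by (auto simp: conf_def)

lemma sink_conf_eq_conf: "sink_conf n X V = conf {1..n} {}"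
  unfolding sink_conf_def conf_def by (rule arg_cong[where f = "subtopology _"]) auto

lemma continuous_into_conf:
  assumes "\<And>i. i \<in> I \<Longrightarrow> continuous_map Z X (\<lambda>z. f z i)"
    and "\<And>z. z \<in> topspace Z \<Longrightarrow> f z \<in> topspace (conf I S)"
  shows "continuous_map Z (conf I S) f"
proof -
  have "continuous_map Z (product_topology (\<lambda>_. X) I) f"
    using assms by (auto simp: continuous_map_componentwise topspace_conf_iff PiE_iff)
  with assms(2) show ?thesis
    by (auto simp: conf_def continuous_map_in_subtopology)
qed

lemma continuous_proj: "i \<in> I \<Longrightarrow> continuous_map (conf I S) X (\<lambda>x. x i)"
  unfolding conf_def by (intro continuous_map_from_subtopology continuous_map_product_projection)

lemma Hausdorff_conf: "Hausdorff_space (conf I S)"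
  unfolding conf_def
  by (intro Hausdorff_space_subtopology) (simp add: Hausdorff_space_product_topology Hausdorff)

text \<open>The collapse of the punctured graph, applied to all particles simultaneously, is a deformation
  retraction onto the finite discrete space of configurations with every particle on a vertex.\<close>

lemma euler_conf_all_punctured:
  assumes I: "finite I" shows "has_euler (conf I E) (int (card V) ^ card I)"
proof -
  let ?Y = "conf I E"
  let ?D = "I \<rightarrow>\<^sub>E V"
  define h where "h = (\<lambda>(s, x). \<lambda>i\<in>I. collapse s (x i))"
  have V_mid: "V \<inter> edge_mid ` E = {}" using edge_mid_in edge_sub by blast
  have D_sub: "?D \<subseteq> topspace ?Y"
    using V_sub V_mid by (force simp: topspace_conf_iff PiE_iff)
  have pts: "x i \<in> topspace punctured" if "x \<in> topspace ?Y" "i \<in> I" for x i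
    using that by (auto simp: topspace_conf_iff PiE_iff)
  have h_in: "h (s, x) \<in> topspace ?Y" if "0 \<le> s" "s \<le> 1" "x \<in> topspace ?Y" for s x
    unfolding topspace_conf_iff
  proof (intro conjI ballI impI)
    have *: "collapse s (x i) \<in> topspace punctured" if "i \<in> I" for i
      using collapse_in_punctured[OF \<open>0 \<le> s\<close> \<open>s \<le> 1\<close> pts[OF \<open>x \<in> topspace ?Y\<close> that]] .
    then show "h (s, x) \<in> I \<rightarrow>\<^sub>E topspace X" by (auto simp: h_def)
    fix i assume i: "i \<in> I"
    show "h (s, x) i \<notin> edge_mid ` E" using *[OF i] i by (auto simp: h_def)
    fix j assume j: "j \<in> I" "i \<noteq> j"
    have xi: "x i \<in> topspace punctured" "x j \<in> topspace punctured" using pts that i j by auto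
    have dis: "x i \<noteq> x j \<or> x i \<in> V" using that(3) i j by (auto simp: topspace_conf_iff)
    have "collapse s (x i) \<noteq> collapse s (x j) \<or> collapse s (x i) \<in> V"
    proof (cases "s = 1")
      case True
      then show ?thesis using collapse_1 xi by simp
    next
      case False
      then show ?thesis
        using dis collapse_inj[OF \<open>0 \<le> s\<close> _ xi] \<open>s \<le> 1\<close> by (metis collapse_V less_eq_real_def)
    qed
    then show "h (s, x) i \<noteq> h (s, x) j \<or> h (s, x) i \<in> V" using i j by (simp add: h_def)
  qed
  have cont: "continuous_map (prod_topology (top_of_set {0..1}) ?Y) ?Y h"
  proof (rule continuous_into_conf)
    fix i assume i: "i \<in> I"
    have "continuous_map ?Y punctured (\<lambda>x. x i)"
      by (rule continuous_map_into_subtopology[OF continuous_proj[OF i]]) (use pts i in auto)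
    then have "continuous_map (prod_topology (top_of_set {0..1::real}) ?Y) punctured (\<lambda>z. snd z i)"
      using continuous_map_compose[OF continuous_map_snd] by (fastforce simp: o_def)
    then have "continuous_map (prod_topology (top_of_set {0..1}) ?Y)
        (prod_topology (top_of_set {0..1::real}) punctured) (\<lambda>z. (fst z, snd z i))"
      unfolding continuous_map_pairwise o_def using continuous_map_fst by simp
    from continuous_map_compose[OF this continuous_collapse]
    have "continuous_map (prod_topology (top_of_set {0..1}) ?Y) X (\<lambda>z. collapse (fst z) (snd z i))"
      by (simp add: o_def continuous_map_in_subtopology)
    then show "continuous_map (prod_topology (top_of_set {0..1}) ?Y) X (\<lambda>z. h z i)"
      by (rule continuous_map_eq) (auto simp: h_def i case_prod_beta)
  qed (use h_in in force)
  have r: "homotopic_with (\<lambda>x. True) ?Y ?Y (\<lambda>x. h (1, x)) id"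
  proof (rule homotopic_with_symD, subst homotopic_with, simp, intro exI[of _ h] conjI ballI)
    fix x assume x: "x \<in> topspace ?Y"
    then show "h (0, x) = id x"
      by (auto simp: h_def topspace_conf_iff PiE_iff collapse_0 extensional_def fun_eq_iff)
  qed (use cont in auto)
  have D: "subtopology ?Y ?D = discrete_topology ?D"
    using D_sub I finite_V Hausdorff_conf
    by (intro subtopology_eq_discrete_topology_finite Hausdorff_imp_t1_space) (auto intro: finite_PiE)
  have h1: "h (1, x) \<in> ?D" if "x \<in> topspace ?Y" for x
    using pts[OF that] collapse_1 by (auto simp: h_def)
  have "continuous_map ?Y ?Y (\<lambda>x. h (1, x))"
    using r homotopic_with_imp_continuous_maps by blast
  then have "retraction_maps ?Y (discrete_topology ?D) (\<lambda>x. h (1, x)) id"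
    unfolding retraction_maps_def D[symmetric]
    using h1 D_sub by (auto simp: continuous_map_in_subtopology h_def collapse_V PiE_iff extensional_def fun_eq_iff)
  with r have "?Y homotopy_equivalent_space discrete_topology ?D"
    by (rule deformation_retract_imp_homotopy_equivalent_space)
  from has_euler_homotopy_equivalent[OF this has_euler_finite_discrete]
  show ?thesis using I finite_V by (simp add: finite_PiE card_PiE)
qed

section \<open>A particle crossing a midpoint\<close>

text \<open>A continuous lower bound for the distances of the particles in \<open>J\<close> from the midpoint of \<open>e\<close>. Each
  factor \<open>2 * gap e (x j)\<close> is at most \<open>1\<close>, so the product is bounded by every single one of them, and it
  vanishes only if some particle is at the midpoint.\<close>

definition clearance :: "'a set \<Rightarrow> nat set \<Rightarrow> (nat \<Rightarrow> 'a) \<Rightarrow> real" where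
  "clearance e J x = 1/2 * (\<Prod>j\<in>J. 2 * gap e (x j))"

lemma continuous_clearance:
  "e \<in> E \<Longrightarrow> finite J \<Longrightarrow> J \<subseteq> I \<Longrightarrow> continuous_map (conf I S) euclideanreal (clearance e J)"
  unfolding clearance_def
  using continuous_map_compose[OF continuous_proj continuous_gap]
  by (intro continuous_intros) (auto simp: o_def)

lemma clearance_bounds:
  assumes "e \<in> E" "finite J"
  shows "0 \<le> clearance e J x" "clearance e J x \<le> 1/2" "j \<in> J \<Longrightarrow> clearance e J x \<le> gap e (x j)"
    and "clearance e J x = 0 \<longleftrightarrow> (\<exists>j\<in>J. x j = edge_mid e)"
proof -
  have f: "0 \<le> 2 * gap e (x j)" "2 * gap e (x j) \<le> 1" for j
    using gap_bounds[OF assms(1), of "x j"] by auto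
  show "0 \<le> clearance e J x" unfolding clearance_def using f by (intro mult_nonneg_nonneg prod_nonneg) auto
  show "clearance e J x \<le> 1/2" unfolding clearance_def using prod_le_1[of J "\<lambda>j. 2 * gap e (x j)"] f by simp
  show "clearance e J x \<le> gap e (x j)" if "j \<in> J"
  proof -
    have "clearance e J x = gap e (x j) * (\<Prod>j\<in>J - {j}. 2 * gap e (x j))"
      unfolding clearance_def using prod.remove[OF assms(2) that, of "\<lambda>j. 2 * gap e (x j)"] by simp
    also have "\<dots> \<le> gap e (x j) * 1"
      using f gap_bounds[OF assms(1)] by (intro mult_left_mono prod_le_1) auto
    finally show ?thesis by simp
  qed
  show "clearance e J x = 0 \<longleftrightarrow> (\<exists>j\<in>J. x j = edge_mid e)"
    unfolding clearance_def using assms by (simp add: gap_eq_0_iff)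
qed

lemma clearance_cong: "(\<And>j. j \<in> J \<Longrightarrow> x j = y j) \<Longrightarrow> clearance e J x = clearance e J y"
  unfolding clearance_def by simp

text \<open>For \<open>a = -1\<close> and \<open>b = 1\<close>, the particle \<open>p\<close> is closer to the midpoint of \<open>e\<close> than the clearance of all
  the others; for \<open>(-1, 0)\<close> and \<open>(0, 1)\<close> it is in addition strictly on one side of the midpoint. If
  another particle is at the midpoint the clearance is zero and the strict inequalities fail.\<close>

definition crossing :: "nat set \<Rightarrow> 'a set set \<Rightarrow> 'a set \<Rightarrow> nat \<Rightarrow> real \<Rightarrow> real \<Rightarrow> (nat \<Rightarrow> 'a) set" where
  "crossing I S e p a b = {x \<in> topspace (conf I S). x p \<in> e \<and>
     a * clearance e (I - {p}) x < coord e (x p) - 1/2 \<and>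
     coord e (x p) - 1/2 < b * clearance e (I - {p}) x}"

context
  fixes I :: "nat set" and S :: "'a set set" and e :: "'a set" and p :: nat
  assumes I: "finite I" and S: "S \<subseteq> E" and e: "e \<in> E" "e \<notin> S" and p: "p \<in> I"
begin

abbreviation (input) "slack \<equiv> clearance e (I - {p})"

lemma slack_bounds:
  "0 \<le> slack x" "slack x \<le> 1/2" "j \<in> I \<Longrightarrow> j \<noteq> p \<Longrightarrow> slack x \<le> gap e (x j)"
  "slack x = 0 \<longleftrightarrow> (\<exists>j\<in>I - {p}. x j = edge_mid e)"
  using clearance_bounds[OF e(1), of "I - {p}"] I by auto

lemma continuous_at_particle:
  "continuous_map (subtopology (conf I S) {x. x p \<in> e}) euclideanreal (\<lambda>x. coord e (x p) - 1/2)"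
proof -
  have "continuous_map (subtopology (conf I S) {x. x p \<in> e}) (subtopology X e) (\<lambda>x. x p)"
    by (intro continuous_map_into_subtopology continuous_map_from_subtopology continuous_proj p) auto
  from continuous_map_compose[OF this continuous_coord[OF e(1)]]
  show ?thesis by (intro continuous_intros) (auto simp: o_def)
qed

lemma openin_crossing: "openin (conf I S) (crossing I S e p a b)"
proof -
  let ?Y = "conf I S" and ?W = "{x \<in> topspace (conf I S). x p \<in> e}"
  have W: "openin ?Y ?W"
    by (rule openin_continuous_map_preimage[OF continuous_proj[OF p] edge_open[OF e(1)]])
  have sub: "subtopology ?Y ?W = subtopology ?Y {x. x p \<in> e}"
    by (rule subtopology_Collect_topspace)
  have slack: "continuous_map (subtopology ?Y ?W) euclideanreal slack"
    by (intro continuous_map_from_subtopology continuous_clearance e) (use I in auto)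
  note co = continuous_at_particle[folded sub]
  have "openin (subtopology ?Y ?W) {x \<in> topspace (subtopology ?Y ?W). coord e (x p) - 1/2 - a * slack x \<in> {0<..}}"
    by (rule openin_continuous_map_preimage[where Y = euclideanreal])
      (auto intro!: continuous_map_diff co continuous_map_real_mult_left slack)
  moreover have "openin (subtopology ?Y ?W) {x \<in> topspace (subtopology ?Y ?W). b * slack x - (coord e (x p) - 1/2) \<in> {0<..}}"
    by (rule openin_continuous_map_preimage[where Y = euclideanreal])
      (auto intro!: continuous_map_diff co continuous_map_real_mult_left slack)
  ultimately have "openin (subtopology ?Y ?W)
      ({x \<in> topspace (subtopology ?Y ?W). coord e (x p) - 1/2 - a * slack x \<in> {0<..}} \<inter>
       {x \<in> topspace (subtopology ?Y ?W). b * slack x - (coord e (x p) - 1/2) \<in> {0<..}})"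
    by (rule openin_Int)
  moreover have "crossing I S e p a b =
      {x \<in> topspace (subtopology ?Y ?W). coord e (x p) - 1/2 - a * slack x \<in> {0<..}} \<inter>
       {x \<in> topspace (subtopology ?Y ?W). b * slack x - (coord e (x p) - 1/2) \<in> {0<..}}"
    by (auto simp: crossing_def)
  ultimately have "openin (subtopology ?Y ?W) (crossing I S e p a b)" by (simp only:)
  then show ?thesis by (rule openin_trans_full[OF _ W])
qed

lemma crossing_clearance_pos:
  assumes "x \<in> crossing I S e p a b" shows "0 < slack x"
  using assms slack_bounds(1)[of x] by (cases "slack x = 0") (auto simp: crossing_def)

text \<open>The position of \<open>p\<close>, measured in units of the clearance of the others, ranges over \<open>(a, b)\<close>
  independently of where the others are, and they avoid the midpoint of \<open>e\<close>. Moving \<open>p\<close> inside this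
  range never produces a collision, because \<open>p\<close> stays nearer to the midpoint than anyone else.\<close>

lemma crossing_homeomorphic:
  assumes ab: "-1 \<le> a" "b \<le> 1"
  shows "subtopology (conf I S) (crossing I S e p a b) homeomorphic_space
    prod_topology (conf (I - {p}) (insert e S)) (top_of_set {a<..<b})"
proof -
  let ?R = "subtopology (conf I S) (crossing I S e p a b)"
  let ?B = "conf (I - {p}) (insert e S)" and ?T = "top_of_set {a<..<b}"
  define f where "f = (\<lambda>x. (restrict x (I - {p}), (coord e (x p) - 1/2) / slack x))"
  define g where "g = (\<lambda>(y, s). \<lambda>i\<in>I. if i = p then \<phi> e (1/2 + s * slack y) else y i)"
  have topR: "topspace ?R = crossing I S e p a b" by (auto simp: crossing_def)
  have slack_restrict: "slack (restrict x (I - {p})) = slack x" for x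
    by (rule clearance_cong) auto
  have pos: "0 < slack y" if "y \<in> topspace ?B" for y
  proof -
    have "slack y \<noteq> 0" using that unfolding slack_bounds(4) by (auto simp: topspace_conf_iff)
    with slack_bounds(1)[of y] show ?thesis by simp
  qed
  have sc: "\<bar>s * slack y\<bar> < slack y" if "y \<in> topspace ?B" "a < s" "s < b" for y s
    using pos[OF that(1)] that ab by (auto simp: abs_mult abs_less_iff)
  have phi_in: "\<phi> e (1/2 + s * slack y) \<in> e" "coord e (\<phi> e (1/2 + s * slack y)) = 1/2 + s * slack y"
    if "y \<in> topspace ?B" "a < s" "s < b" for y s
    using sc[OF that] slack_bounds(2)[of y] e(1)
    by (auto intro!: phi_in_edge coord_phi simp: abs_less_iff)
  have f_in: "restrict x (I - {p}) \<in> topspace ?B" "a < (coord e (x p) - 1/2) / slack x" "(coord e (x p) - 1/2) / slack x < b"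
    if x: "x \<in> crossing I S e p a b" for x
  proof -
    have "slack x > 0" using crossing_clearance_pos[OF x] .
    then have "\<forall>j\<in>I - {p}. x j \<noteq> edge_mid e" using slack_bounds(4)[of x] by auto
    then show "restrict x (I - {p}) \<in> topspace ?B"
      using x by (auto simp: crossing_def topspace_conf_iff PiE_iff)
    show "a < (coord e (x p) - 1/2) / slack x" "(coord e (x p) - 1/2) / slack x < b"
      using x \<open>slack x > 0\<close> by (auto simp: crossing_def pos_less_divide_eq pos_divide_less_eq)
  qed
  have cg: "slack (g (y, s)) = slack y" for y s
    by (rule clearance_cong) (auto simp: g_def)
  have g_in: "g (y, s) \<in> crossing I S e p a b" if ys: "y \<in> topspace ?B" "a < s" "s < b" for y s
  proof -
    note ph = phi_in[OF ys]
    have gp: "g (y, s) p = \<phi> e (1/2 + s * slack y)" using p by (simp add: g_def)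
    have gj: "g (y, s) j = y j" if "j \<in> I" "j \<noteq> p" for j using that by (simp add: g_def)
    have new: "\<phi> e (1/2 + s * slack y) \<noteq> y j" if "j \<in> I" "j \<noteq> p" for j
    proof
      assume "\<phi> e (1/2 + s * slack y) = y j"
      then have "gap e (y j) = \<bar>s * slack y\<bar>" using ph by (auto simp: gap_def)
      then show False using sc[OF ys] slack_bounds(3)[OF that, of y] by simp
    qed
    have mid: "\<phi> e (1/2 + s * slack y) \<notin> edge_mid ` S"
      using ph(1) edge_mid_in_iff e S by auto
    have "g (y, s) \<in> topspace (conf I S)"
      unfolding topspace_conf_iff
    proof (intro conjI ballI impI)
      show "g (y, s) \<in> I \<rightarrow>\<^sub>E topspace X"
        using ys(1) ph(1) edge_sub[OF e(1)] by (auto simp: g_def topspace_conf_iff PiE_iff)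
      fix i assume i: "i \<in> I"
      show "g (y, s) i \<notin> edge_mid ` S"
        using mid gp gj i ys(1) by (cases "i = p") (auto simp: topspace_conf_iff)
      fix j assume j: "j \<in> I" "i \<noteq> j"
      show "g (y, s) i \<noteq> g (y, s) j \<or> g (y, s) i \<in> V"
        using i j gp gj new[OF i] new[OF j(1)] ys(1)
        by (cases "i = p"; cases "j = p") (auto simp: topspace_conf_iff)
    qed
    then show ?thesis
      using ph ys pos[OF ys(1)] by (simp add: crossing_def gp cg)
  qed
  have "homeomorphic_maps ?R (prod_topology ?B ?T) f g"
    unfolding homeomorphic_maps_def
  proof (intro conjI ballI)
    have "continuous_map ?R ?B (\<lambda>x. restrict x (I - {p}))"
    proof (rule continuous_into_conf)
      fix i assume i: "i \<in> I - {p}"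
      have "continuous_map ?R X (\<lambda>x. x i)"
        by (intro continuous_map_from_subtopology continuous_proj) (use i in auto)
      then show "continuous_map ?R X (\<lambda>x. restrict x (I - {p}) i)" using i by simp
    qed (use f_in(1) topR in auto)
    moreover have "continuous_map ?R ?T (\<lambda>x. (coord e (x p) - 1/2) / slack x)"
    proof (rule continuous_map_into_subtopology)
      have "continuous_map ?R euclideanreal (\<lambda>x. coord e (x p) - 1/2)"
        by (rule continuous_map_from_subtopology_mono[OF continuous_at_particle]) (auto simp: crossing_def)
      moreover have "continuous_map ?R euclideanreal slack"
        by (intro continuous_map_from_subtopology continuous_clearance e) (use I in auto)
      ultimately show "continuous_map ?R euclideanreal (\<lambda>x. (coord e (x p) - 1/2) / slack x)"
        using crossing_clearance_pos topR by (intro continuous_map_real_divide) (auto simp: less_imp_neq[symmetric])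
    qed (use f_in topR in auto)
    ultimately show "continuous_map ?R (prod_topology ?B ?T) f"
      unfolding continuous_map_pairwise f_def o_def by simp
    have cont_s: "continuous_map (prod_topology ?B ?T) euclideanreal (\<lambda>z. 1/2 + snd z * slack (fst z))"
    proof -
      have "continuous_map ?B euclideanreal slack" by (intro continuous_clearance e) (use I in auto)
      from continuous_map_compose[OF continuous_map_fst this]
      have "continuous_map (prod_topology ?B ?T) euclideanreal (\<lambda>z. slack (fst z))" by (simp add: o_def)
      then show ?thesis
        by (intro continuous_intros continuous_map_into_fulltopology[OF continuous_map_snd]) auto
    qed
    have s_in: "1/2 + snd z * slack (fst z) \<in> {0..1}" if "z \<in> topspace (prod_topology ?B ?T)" for z
      using that sc[of "fst z" "snd z"] slack_bounds(2)[of "fst z"] by (cases z) (auto simp: abs_less_iff)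
    have "continuous_map (prod_topology ?B ?T) (conf I S) g"
    proof (rule continuous_into_conf)
      fix i assume i: "i \<in> I"
      show "continuous_map (prod_topology ?B ?T) X (\<lambda>z. g z i)"
      proof (cases "i = p")
        case True
        have "continuous_map (prod_topology ?B ?T) (top_of_set {0..1}) (\<lambda>z. 1/2 + snd z * slack (fst z))"
          by (rule continuous_map_into_subtopology[OF cont_s]) (use s_in in blast)
        from continuous_map_compose[OF this continuous_phi[OF e(1)]]
        show ?thesis
          by (rule continuous_map_eq) (auto simp: g_def True p)
      next
        case False
        then have "continuous_map ?B X (\<lambda>y. y i)" using i by (intro continuous_proj) auto
        from continuous_map_compose[OF continuous_map_fst this]
        show ?thesis
          by (rule continuous_map_eq) (auto simp: g_def False i)
      qed
    next
      fix z assume "z \<in> topspace (prod_topology ?B ?T)"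
      then show "g z \<in> topspace (conf I S)" using g_in by (cases z) (auto simp: crossing_def)
    qed
    then show "continuous_map (prod_topology ?B ?T) ?R g"
      using g_in by (auto simp: continuous_map_in_subtopology)
  next
    fix x assume "x \<in> topspace ?R"
    then have x: "x \<in> crossing I S e p a b" using topR by simp
    have "x p \<in> e" using x by (simp add: crossing_def)
    then have "\<phi> e (1/2 + (coord e (x p) - 1/2) / slack x * slack x) = x p"
      using crossing_clearance_pos[OF x] phi_coord[OF e(1)] by simp
    moreover have "x \<in> extensional I" using x by (auto simp: crossing_def topspace_conf_iff PiE_iff)
    ultimately show "g (f x) = x"
      unfolding f_def g_def prod.case slack_restrict
      by (auto simp: fun_eq_iff extensional_def)
  next
    fix z assume "z \<in> topspace (prod_topology ?B ?T)"
    then obtain y s where z: "z = (y, s)" and ys: "y \<in> topspace ?B" "a < s" "s < b" by (cases z) auto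
    have "g (y, s) p = \<phi> e (1/2 + s * slack y)" using p by (simp add: g_def)
    moreover have "restrict (g (y, s)) (I - {p}) = y"
      using ys(1) by (auto simp: g_def fun_eq_iff restrict_def topspace_conf_iff PiE_iff extensional_def)
    ultimately show "f (g z) = z"
      using phi_in[OF ys] pos[OF ys(1)] by (simp add: f_def z cg)
  qed
  then show ?thesis by (auto simp: homeomorphic_space_def)
qed

lemma euler_crossing:
  assumes "-1 \<le> a" "a < b" "b \<le> 1" "has_euler (conf (I - {p}) (insert e S)) k"
  shows "has_euler (subtopology (conf I S) (crossing I S e p a b)) k"
proof (rule has_euler_homotopy_equivalent)
  show "subtopology (conf I S) (crossing I S e p a b) homotopy_equivalent_space
      prod_topology (conf (I - {p}) (insert e S)) (top_of_set {a<..<b})"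
    by (rule homeomorphic_imp_homotopy_equivalent_space[OF crossing_homeomorphic[OF assms(1,3)]])
  have "contractible {a<..<b}" by (intro convex_imp_contractible convex_real_interval)
  then show "has_euler (prod_topology (conf (I - {p}) (insert e S)) (top_of_set {a<..<b})) k"
    using assms by (intro has_euler_prod_contractible) auto
qed

end

lemma crossing_unique:
  assumes "finite I" "e \<in> E" "p \<in> I" "q \<in> I"
    and x: "x \<in> crossing I S e p (-1) 1" "x \<in> crossing I S e q (-1) 1"
  shows "p = q"
proof (rule ccontr)
  assume "p \<noteq> q"
  have "gap e (x p) < clearance e (I - {p}) x" "gap e (x q) < clearance e (I - {q}) x"
    using x by (auto simp: crossing_def gap_def abs_less_iff)
  moreover have "clearance e (I - {p}) x \<le> gap e (x q)" "clearance e (I - {q}) x \<le> gap e (x p)"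
    using assms \<open>p \<noteq> q\<close> by (auto intro!: clearance_bounds)
  ultimately show False by simp
qed

lemma crossing_mono:
  assumes "e \<in> E" "finite I" "a' \<le> a" "b \<le> b'" shows "crossing I S e p a b \<subseteq> crossing I S e p a' b'"
proof
  fix x assume x: "x \<in> crossing I S e p a b"
  have "0 \<le> clearance e (I - {p}) x" using clearance_bounds(1)[OF assms(1)] assms(2) by simp
  then have "a' * clearance e (I - {p}) x \<le> a * clearance e (I - {p}) x"
    "b * clearance e (I - {p}) x \<le> b' * clearance e (I - {p}) x"
    using assms by (auto intro: mult_right_mono)
  with x show "x \<in> crossing I S e p a' b'" by (auto simp: crossing_def)
qed

text \<open>The open set \<open>U\<close> of configurations avoiding the midpoint of \<open>e\<close> and the open set \<open>W\<close> of those with a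
  crossing particle cover the space, since two particles cannot share the midpoint. For each \<open>p\<close>, the
  crossing region is equivalent to the configurations of the other particles, and it loses its middle
  slice in \<open>U\<close>, leaving two copies. Inclusion-exclusion then contributes \<open>k p - 2 * k p\<close>.\<close>

lemma euler_conf_puncture:
  assumes I: "finite I" and S: "S \<subseteq> E" and e: "e \<in> E" "e \<notin> S"
    and u: "has_euler (conf I (insert e S)) u"
    and k: "\<And>p. p \<in> I \<Longrightarrow> has_euler (conf (I - {p}) (insert e S)) (k p)"
  shows "has_euler (conf I S) (u - (\<Sum>p\<in>I. k p))"
proof -
  let ?Y = "conf I S"
  let ?R = "crossing I S e"
  define U where "U = {x \<in> topspace ?Y. \<forall>i\<in>I. x i \<noteq> edge_mid e}"
  define W where "W = (\<Union>p\<in>I. ?R p (-1) 1)"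
  have U_eq: "subtopology ?Y U = conf I (insert e S)"
  proof -
    have "subtopology ?Y U = subtopology ?Y {x. \<forall>i\<in>I. x i \<noteq> edge_mid e}"
      unfolding U_def by (rule subtopology_Collect_topspace)
    also have "\<dots> = conf I (insert e S)"
      unfolding conf_def subtopology_subtopology by (rule arg_cong[where f = "subtopology _"]) auto
    finally show ?thesis .
  qed
  have U_open: "openin ?Y U"
  proof -
    have "openin ?Y {x \<in> topspace ?Y. x i \<in> topspace X - {edge_mid e}}" if "i \<in> I" for i
    proof (rule openin_continuous_map_preimage[OF continuous_proj[OF that]])
      have "edge_mid e \<in> topspace X" using edge_mid_in[OF e(1)] edge_sub[OF e(1)] by auto
      then show "openin X (topspace X - {edge_mid e})"
        by (intro openin_diff closedin_Hausdorff_finite Hausdorff) auto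
    qed
    then have "openin ?Y (topspace ?Y \<inter> (\<Inter>i\<in>I. {x \<in> topspace ?Y. x i \<in> topspace X - {edge_mid e}}))"
      using I by (cases "I = {}") (auto intro!: openin_Int openin_Inter)
    moreover have "U = topspace ?Y \<inter> (\<Inter>i\<in>I. {x \<in> topspace ?Y. x i \<in> topspace X - {edge_mid e}})"
    proof -
      have "x i \<in> topspace X" if "x \<in> topspace ?Y" "i \<in> I" for x i
        using that by (auto simp: topspace_conf_iff PiE_iff)
      then show ?thesis unfolding U_def by blast
    qed
    ultimately show ?thesis by simp
  qed
  have op: "openin ?Y (?R p a b)" if "p \<in> I" for p a b
    by (rule openin_crossing[OF I S e that])
  have W_open: "openin ?Y W" unfolding W_def using op by blast
  have cover: "U \<union> W = topspace ?Y"
  proof -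
    have "x \<in> W" if x: "x \<in> topspace ?Y" "x \<notin> U" for x
    proof -
      obtain p where p: "p \<in> I" "x p = edge_mid e" using x by (auto simp: U_def)
      have "edge_mid e \<notin> V" using edge_mid_in[OF e(1)] edge_sub[OF e(1)] by auto
      then have "\<forall>j\<in>I - {p}. x j \<noteq> edge_mid e"
        using x(1) p unfolding topspace_conf_iff by (metis Diff_iff singletonI)
      then have "clearance e (I - {p}) x > 0"
        using clearance_bounds(1)[OF e(1), of "I - {p}" x] clearance_bounds(4)[OF e(1), of "I - {p}" x] I
        by (auto simp: less_le)
      then have "x \<in> ?R p (-1) 1"
        using x p edge_mid_in[OF e(1)] by (simp add: crossing_def coord_edge_mid[OF e(1)])
      then show ?thesis using p by (auto simp: W_def)
    qed
    then show ?thesis using W_open[THEN openin_subset] by (auto simp: U_def)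
  qed
  have halves: "?R p (-1) 1 \<inter> U = ?R p (-1) 0 \<union> ?R p 0 1" if p: "p \<in> I" for p
  proof -
    \<comment> \<open>in the crossing region only \<open>p\<close> can be at the midpoint, which means rescaled position zero\<close>
    have "x \<in> ?R p (-1) 0 \<union> ?R p 0 1 \<longleftrightarrow> x \<in> U" if x: "x \<in> ?R p (-1) 1" for x
    proof -
      have xp: "x p \<in> e" "x \<in> topspace ?Y" using x by (auto simp: crossing_def)
      have "clearance e (I - {p}) x > 0" by (rule crossing_clearance_pos[OF I S e p x])
      then have "\<forall>j\<in>I - {p}. x j \<noteq> edge_mid e"
        using clearance_bounds(4)[OF e(1), of "I - {p}" x] I by auto
      then have "x \<in> U \<longleftrightarrow> x p \<noteq> edge_mid e" using p xp by (auto simp: U_def)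
      also have "\<dots> \<longleftrightarrow> coord e (x p) \<noteq> 1/2" using coord_eq_half_iff[OF e(1) xp(1)] by simp
      also have "\<dots> \<longleftrightarrow> x \<in> ?R p (-1) 0 \<union> ?R p 0 1"
        using x by (auto simp: crossing_def)
      finally show ?thesis by simp
    qed
    moreover have "?R p (-1) 0 \<union> ?R p 0 1 \<subseteq> ?R p (-1) 1"
      using crossing_mono[OF e(1) I] by simp
    ultimately show ?thesis by blast
  qed
  have W_euler: "has_euler (subtopology ?Y W) (\<Sum>p\<in>I. k p)"
    unfolding W_def
  proof (rule has_euler_disjoint_open_Union[OF I op])
    show "disjoint_family_on (\<lambda>p. ?R p (-1) 1) I"
      using crossing_unique[OF I e(1)] by (fastforce simp: disjoint_family_on_def)
    show "has_euler (subtopology ?Y (?R p (-1) 1)) (k p)" if "p \<in> I" for p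
      by (rule euler_crossing[OF I S e that _ _ _ k[OF that]]) auto
  qed
  have UW_euler: "has_euler (subtopology ?Y (U \<inter> W)) (\<Sum>p\<in>I. k p + k p)"
  proof -
    have "U \<inter> W = (\<Union>p\<in>I. ?R p (-1) 0 \<union> ?R p 0 1)"
      unfolding W_def using halves by blast
    moreover have "has_euler (subtopology ?Y (\<Union>p\<in>I. ?R p (-1) 0 \<union> ?R p 0 1)) (\<Sum>p\<in>I. k p + k p)"
    proof (rule has_euler_disjoint_open_Union[OF I])
      show "openin ?Y (?R p (-1) 0 \<union> ?R p 0 1)" if "p \<in> I" for p using op[OF that] by blast
      show "disjoint_family_on (\<lambda>p. ?R p (-1) 0 \<union> ?R p 0 1) I"
        using crossing_unique[OF I e(1)] halves by (fastforce simp: disjoint_family_on_def)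
      fix p assume p: "p \<in> I"
      define Q where "Q = (\<lambda>i::bool. if i then ?R p (-1) 0 else ?R p 0 1)"
      have "has_euler (subtopology ?Y (\<Union>i\<in>{True, False}. Q i)) (\<Sum>i\<in>{True, False}. k p)"
      proof (rule has_euler_disjoint_open_Union)
        show "disjoint_family_on Q {True, False}"
          by (auto simp: disjoint_family_on_def Q_def crossing_def)
        show "has_euler (subtopology ?Y (Q i)) (k p)" for i
          unfolding Q_def using euler_crossing[OF I S e p _ _ _ k[OF p]] by auto
      qed (use op[OF p] in \<open>auto simp: Q_def\<close>)
      then show "has_euler (subtopology ?Y (?R p (-1) 0 \<union> ?R p 0 1)) (k p + k p)"
        by (simp add: Q_def Un_commute)
    qed
    ultimately show ?thesis by simp
  qed
  have "has_euler ?Y (u + (\<Sum>p\<in>I. k p) - (\<Sum>p\<in>I. k p + k p))"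
    by (rule has_euler_open_Un[OF U_open W_open cover _ W_euler UW_euler]) (simp add: U_eq u)
  then show ?thesis by (simp flip: sum_distrib_left)
qed

end

section \<open>The counting formula\<close>

definition sink_euler :: "nat \<Rightarrow> nat \<Rightarrow> nat \<Rightarrow> int" where
  "sink_euler n m v = (\<Sum>i = 0..m. (-1) ^ i * int (n choose i) * int (m choose i) * fact i * int v ^ (n - i))"

lemma sink_euler_0: "sink_euler n 0 v = int v ^ n"
  by (simp add: sink_euler_def)

text \<open>The same recursion as for the configuration spaces, from the Pascal rule in \<open>m\<close> and the absorption
  identity for \<open>n choose Suc i\<close>.\<close>

lemma sink_euler_Suc: "sink_euler n (Suc m) v = sink_euler n m v - int n * sink_euler (n - 1) m v"
proof -
  define t where "t = (\<lambda>i. (-1) ^ i * int (n choose i) * fact i * int v ^ (n - i))"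
  have "sink_euler n (Suc m) v = (\<Sum>i\<le>Suc m. t i * int (Suc m choose i))"
    unfolding sink_euler_def t_def atMost_atLeast0 by (simp add: mult_ac)
  also have "\<dots> = t 0 + (\<Sum>i\<le>m. t (Suc i) * int (Suc m choose Suc i))"
    by (subst sum.atMost_Suc_shift) simp
  also have "\<dots> = (t 0 + (\<Sum>i\<le>m. t (Suc i) * int (m choose Suc i))) + (\<Sum>i\<le>m. t (Suc i) * int (m choose i))"
    by (simp add: algebra_simps sum.distrib)
  also have "t 0 + (\<Sum>i\<le>m. t (Suc i) * int (m choose Suc i)) = (\<Sum>i\<le>Suc m. t i * int (m choose i))"
    by (subst sum.atMost_Suc_shift) simp
  also have "\<dots> = sink_euler n m v"
    unfolding sink_euler_def t_def atMost_atLeast0[symmetric] by (simp add: mult_ac)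
  also have "(\<Sum>i\<le>m. t (Suc i) * int (m choose i)) = - int n * sink_euler (n - 1) m v"
  proof -
    have "t (Suc i) * int (m choose i) =
      - int n * ((-1) ^ i * int (n - 1 choose i) * int (m choose i) * fact i * int v ^ (n - 1 - i))" for i
    proof -
      have absorb: "int (n choose Suc i) * fact (Suc i) = int n * int (n - 1 choose i) * fact i"
      proof (cases n)
        case (Suc n')
        have "int (n choose Suc i) * fact (Suc i) = int (Suc i * (Suc n' choose Suc i)) * fact i"
          unfolding Suc fact_Suc of_nat_mult by (simp only: mult_ac of_nat_id)
        also have "Suc i * (Suc n' choose Suc i) = Suc n' * (n' choose i)"
          by (rule Suc_times_binomial)
        finally show ?thesis by (simp only: Suc of_nat_mult diff_Suc_1)
      qed simp
      have "t (Suc i) = - ((-1) ^ i * (int (n choose Suc i) * fact (Suc i)) * int v ^ (n - Suc i))"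
        by (simp add: t_def mult_ac del: fact_Suc)
      also have "\<dots> = - ((-1) ^ i * (int n * int (n - 1 choose i) * fact i) * int v ^ (n - 1 - i))"
        unfolding absorb by simp
      finally show ?thesis by (simp add: mult_ac)
    qed
    then show ?thesis
      unfolding sink_euler_def atMost_atLeast0 by (simp only: sum_distrib_left)
  qed
  finally show ?thesis by simp
qed

lemma (in parametrized_graph) euler_conf:
  assumes "finite I" "S \<subseteq> E"
  shows "has_euler (conf I S) (sink_euler (card I) (card (E - S)) (card V))"
  using assms
proof (induction "card (E - S)" arbitrary: I S)
  case 0
  then have "S = E" using finite_E by auto
  then show ?case using euler_conf_all_punctured[OF 0(2)] by (simp add: sink_euler_0)
next
  case (Suc m)
  then obtain e where e: "e \<in> E" "e \<notin> S" by (metis Diff_eq_empty_iff card.empty nat.distinct(1) subsetI)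
  have "E - insert e S = E - S - {e}" by blast
  then have m: "card (E - insert e S) = m" using Suc(2) e finite_E by simp
  have IH: "has_euler (conf J (insert e S)) (sink_euler (card J) m (card V))" if "finite J" for J
    using Suc(1)[of "insert e S" J] m that e Suc.prems(2) by simp
  have "has_euler (conf I S) (sink_euler (card I) m (card V) - (\<Sum>p\<in>I. sink_euler (card I - 1) m (card V)))"
  proof (rule euler_conf_puncture[OF Suc.prems e IH])
    show "has_euler (conf (I - {p}) (insert e S)) (sink_euler (card I - 1) m (card V))" if "p \<in> I" for p
      using IH[of "I - {p}"] Suc.prems(1) that by simp
  qed (use Suc.prems in auto)
  then show ?case using Suc(2) by (simp add: sink_euler_Suc flip: Suc(2))
qed

lemma sink_conf_euler:
  assumes "CW_graph X V E"
  shows "has_euler (sink_conf n X V) (sink_euler n (card E) (card V))"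
proof -
  have "\<forall>e\<in>E. \<exists>\<phi>. characteristic_map X V e \<phi>"
    using assms by (simp add: CW_graph_def one_dim_CW_complex_def)
  then obtain \<phi> where "\<forall>e\<in>E. characteristic_map X V e (\<phi> e)" by metis
  then interpret parametrized_graph X V E \<phi> using assms by unfold_locales auto
  show ?thesis using euler_conf[of "{1..n}" "{}"] by (simp add: sink_conf_eq_conf)
qed

theorem corollary3p5:
  fixes G :: "'a topology" and V :: "'a set" and E :: "'a set set" and n :: nat
  assumes "CW_graph G V E"
  shows "euler_defined (sink_conf n G V) \<and>
    euler_characteristic (sink_conf n G V) =
      (\<Sum>i = 0..card E. (-1) ^ i * int (n choose i) * int (card E choose i) * fact i
                          * int (card V) ^ (n - i)) \<and>
    (\<forall>(G' :: 'b topology) V' E'.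
       CW_graph G' V' E' \<and> card E' = card E \<and> card V' = card V \<longrightarrow>
       euler_characteristic (sink_conf n G' V') = euler_characteristic (sink_conf n G V))"
proof (intro conjI allI impI)
  show "euler_defined (sink_conf n G V)"
    by (rule has_euler_imp[OF sink_conf_euler[OF assms]])
  show "euler_characteristic (sink_conf n G V) =
      (\<Sum>i = 0..card E. (-1) ^ i * int (n choose i) * int (card E choose i) * fact i
                          * int (card V) ^ (n - i))"
    using has_euler_imp(2)[OF sink_conf_euler[OF assms]] by (simp add: sink_euler_def)
  fix G' :: "'b topology" and V' E'
  assume "CW_graph G' V' E' \<and> card E' = card E \<and> card V' = card V"
  then show "euler_characteristic (sink_conf n G' V') = euler_characteristic (sink_conf n G V)"
    using has_euler_imp(2)[OF sink_conf_euler[OF assms]] has_euler_imp(2)[OF sink_conf_euler[of G' V' E']]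
    by simp
qed

end
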